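(* Let $n\geq 0$. Let $S$ be a monoid, let $T$ be a (two-sided) ideal of $S$, and suppose that $T$ has a two-sided identity element. Then $S$ is of type left-$\mathrm{FP}_n$ if and only if $T$ is of type left-$\mathrm{FP}_n$.
   Context: For a monoid $S$, $\mathbb{Z}S$ denotes the integral monoid ring, and $\mathbb{Z}$ is regarded as the trivial left $\mathbb{Z}S$-module via the augmentation $\epsilon_S:\mathbb{Z}S\to\mathbb{Z}$, $s\mapsto 1$ ($s\in S$). For $n\geq 0$, the monoid $S$ is of type left-$\mathrm{FP}_n$ if there is an exact sequence $A_n\to A_{n-1}\to\cdots\to A_0\to\mathbb{Z}\to 0$ of left $\mathbb{Z}S$-modules with $A_0,\ldots,A_n$ finitely generated free left $\mathbb{Z}S$-modules. The ideal $T$ is regarded as a monoid with its own identity element (which need not be the identity of $S$). *)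

theory Defs
  imports "HOL-Algebra.Free_Abelian_Groups" "HOL-Algebra.Module" "HOL-Algebra.IntRing"
begin

definition monoid_ideal :: "'a set \<Rightarrow> ('a, 'b) monoid_scheme \<Rightarrow> bool"
  where "monoid_ideal T S \<longleftrightarrow> T \<subseteq> carrier S \<and>
    (\<forall>s\<in>carrier S. \<forall>t\<in>T. s \<otimes>\<^bsub>S\<^esub> t \<in> T \<and> t \<otimes>\<^bsub>S\<^esub> s \<in> T)"

text \<open>The integral monoid ring: finitely supported functions \<^typ>\<open>'a \<Rightarrow>\<^sub>0 int\<close> with support in
  the carrier, under convolution.\<close>

definition monoid_ring :: "('a, 'b) monoid_scheme \<Rightarrow> ('a \<Rightarrow>\<^sub>0 int) ring"
  where "monoid_ring S =
    \<lparr> carrier = {x. Poly_Mapping.keys x \<subseteq> carrier S},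
      monoid.mult = (\<lambda>x y. frag_extend (\<lambda>s. frag_extend (\<lambda>t. frag_of (s \<otimes>\<^bsub>S\<^esub> t)) y) x),
      one = frag_of \<one>\<^bsub>S\<^esub>,
      zero = 0,
      add = (+) \<rparr>"

definition augmentation :: "('a \<Rightarrow>\<^sub>0 int) \<Rightarrow> int"
  where "augmentation x = (\<Sum>s\<in>Poly_Mapping.keys x. Poly_Mapping.lookup x s)"

text \<open>The locale \<^locale>\<open>module\<close> requires a commutative ring of scalars; here the ring of scalars is
  arbitrary.\<close>

locale left_module = R?: ring R + M?: abelian_group M
  for R :: "('r, 'p) ring_scheme" (structure) and M :: "('r, 'm, 'q) module_scheme" (structure) +
  assumes smult_closed [simp, intro]:
      "\<lbrakk>a \<in> carrier R; x \<in> carrier M\<rbrakk> \<Longrightarrow> a \<odot>\<^bsub>M\<^esub> x \<in> carrier M"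
    and smult_l_distr:
      "\<lbrakk>a \<in> carrier R; b \<in> carrier R; x \<in> carrier M\<rbrakk> \<Longrightarrow>
      (a \<oplus> b) \<odot>\<^bsub>M\<^esub> x = a \<odot>\<^bsub>M\<^esub> x \<oplus>\<^bsub>M\<^esub> b \<odot>\<^bsub>M\<^esub> x"
    and smult_r_distr:
      "\<lbrakk>a \<in> carrier R; x \<in> carrier M; y \<in> carrier M\<rbrakk> \<Longrightarrow>
      a \<odot>\<^bsub>M\<^esub> (x \<oplus>\<^bsub>M\<^esub> y) = a \<odot>\<^bsub>M\<^esub> x \<oplus>\<^bsub>M\<^esub> a \<odot>\<^bsub>M\<^esub> y"
    and smult_assoc1:
      "\<lbrakk>a \<in> carrier R; b \<in> carrier R; x \<in> carrier M\<rbrakk> \<Longrightarrow>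
      (a \<otimes> b) \<odot>\<^bsub>M\<^esub> x = a \<odot>\<^bsub>M\<^esub> (b \<odot>\<^bsub>M\<^esub> x)"
    and smult_one [simp]: "x \<in> carrier M \<Longrightarrow> \<one> \<odot>\<^bsub>M\<^esub> x = x"

definition left_module_hom ::
    "('r, 'p) ring_scheme \<Rightarrow> ('r, 'm, 'q) module_scheme \<Rightarrow> ('r, 'n, 's) module_scheme \<Rightarrow> ('m \<Rightarrow> 'n) set"
  where "left_module_hom R M N =
    {f. f \<in> carrier M \<rightarrow> carrier N \<and>
        (\<forall>x\<in>carrier M. \<forall>y\<in>carrier M. f (x \<oplus>\<^bsub>M\<^esub> y) = f x \<oplus>\<^bsub>N\<^esub> f y) \<and>
        (\<forall>r\<in>carrier R. \<forall>x\<in>carrier M. f (r \<odot>\<^bsub>M\<^esub> x) = r \<odot>\<^bsub>N\<^esub> f x)}"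

text \<open>A finitely generated free module is a module with a finite basis; a basis is a subset through
  which every element is written uniquely as a linear combination.\<close>

definition finite_module_basis ::
    "('r, 'p) ring_scheme \<Rightarrow> ('r, 'm, 'q) module_scheme \<Rightarrow> 'm set \<Rightarrow> bool"
  where "finite_module_basis R M B \<longleftrightarrow> finite B \<and> B \<subseteq> carrier M \<and>
    (\<forall>x\<in>carrier M. \<exists>!c. c \<in> B \<rightarrow>\<^sub>E carrier R \<and> x = (\<Oplus>\<^bsub>M\<^esub>b\<in>B. c b \<odot>\<^bsub>M\<^esub> b))"

definition fg_free_module :: "('r, 'p) ring_scheme \<Rightarrow> ('r, 'm, 'q) module_scheme \<Rightarrow> bool"
  where "fg_free_module R M \<longleftrightarrow> left_module R M \<and> (\<exists>B. finite_module_basis R M B)"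

definition trivial_module :: "('a \<Rightarrow>\<^sub>0 int, int) module"
  where "trivial_module =
    ring.extend \<Z> \<lparr> smult = (\<lambda>r k. augmentation r * k) \<rparr>"

text \<open>\<open>free_partial_resolution n S A d \<epsilon>\<close>: the sequence
  \<open>A n \<rightarrow> A (n - 1) \<rightarrow> \<dots> \<rightarrow> A 0 \<rightarrow> \<Z> \<rightarrow> 0\<close>, with maps \<open>d i : A (i + 1) \<rightarrow> A i\<close> and
  \<open>\<epsilon> : A 0 \<rightarrow> \<Z>\<close>, is exact and consists of finitely generated free left modules over the monoid
  ring of \<open>S\<close> (apart from \<open>\<Z>\<close>). Nothing is required of the kernel of \<open>d (n - 1)\<close>, respectively
  of \<open>\<epsilon>\<close> if \<open>n = 0\<close>.\<close>

definition free_partial_resolution ::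
    "nat \<Rightarrow> ('a, 'b) monoid_scheme \<Rightarrow> (nat \<Rightarrow> ('a \<Rightarrow>\<^sub>0 int, 'm) module) \<Rightarrow>
     (nat \<Rightarrow> 'm \<Rightarrow> 'm) \<Rightarrow> ('m \<Rightarrow> int) \<Rightarrow> bool"
  where "free_partial_resolution n S A d \<epsilon> \<longleftrightarrow>
    (\<forall>i\<le>n. fg_free_module (monoid_ring S) (A i)) \<and>
    (\<forall>i<n. d i \<in> left_module_hom (monoid_ring S) (A (Suc i)) (A i)) \<and>
    \<epsilon> \<in> left_module_hom (monoid_ring S) (A 0) trivial_module \<and>
    \<epsilon> ` carrier (A 0) = carrier (trivial_module :: ('a \<Rightarrow>\<^sub>0 int, int) module) \<and>
    (0 < n \<longrightarrow> d 0 ` carrier (A 1) =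
       a_kernel (A 0) (trivial_module :: ('a \<Rightarrow>\<^sub>0 int, int) module) \<epsilon>) \<and>
    (\<forall>i. Suc i < n \<longrightarrow> d (Suc i) ` carrier (A (Suc (Suc i))) = a_kernel (A (Suc i)) (A i) (d i))"

text \<open>The modules have to live in a fixed type. The type \<^typ>\<open>nat \<Rightarrow> 'a \<Rightarrow>\<^sub>0 int\<close> contains a copy of
  every finitely generated free module over the monoid ring, so that this is no restriction; see
  lemma \<open>left_FP_if_resolution\<close> below.\<close>

definition left_FP :: "nat \<Rightarrow> ('a, 'b) monoid_scheme \<Rightarrow> bool"
  where "left_FP n S \<longleftrightarrow>
    (\<exists>(A :: nat \<Rightarrow> ('a \<Rightarrow>\<^sub>0 int, nat \<Rightarrow> 'a \<Rightarrow>\<^sub>0 int) module) d \<epsilon>. free_partial_resolution n S A d \<epsilon>)"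


subsection \<open>The monoid ring and its trivial module\<close>

lemma monoid_ring_simps [simp]:
  "carrier (monoid_ring S) = {x. Poly_Mapping.keys x \<subseteq> carrier S}"
  "x \<otimes>\<^bsub>monoid_ring S\<^esub> y = frag_extend (\<lambda>s. frag_extend (\<lambda>t. frag_of (s \<otimes>\<^bsub>S\<^esub> t)) y) x"
  "\<one>\<^bsub>monoid_ring S\<^esub> = frag_of \<one>\<^bsub>S\<^esub>"
  "\<zero>\<^bsub>monoid_ring S\<^esub> = 0"
  "x \<oplus>\<^bsub>monoid_ring S\<^esub> y = x + y"
  by (simp_all add: monoid_ring_def)

lemma trivial_module_simps [simp]:
  "carrier trivial_module = UNIV"
  "\<zero>\<^bsub>trivial_module\<^esub> = 0"
  "x \<oplus>\<^bsub>trivial_module\<^esub> y = x + y"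
  "r \<odot>\<^bsub>trivial_module\<^esub> k = augmentation r * k"
  by (simp_all add: trivial_module_def ring.defs)

lemma frag_extend_fun_add:
  "frag_extend (\<lambda>s. f s + g s) x = frag_extend f x + frag_extend g x"
  by (simp add: frag_extend_def frag_cmul_distrib2 sum.distrib)

lemma frag_extend_fun_0: "frag_extend (\<lambda>s. 0) x = 0"
  by (simp add: frag_extend_def)

lemma frag_extend_fun_diff:
  "frag_extend (\<lambda>s. f s - g s) x = frag_extend f x - frag_extend g x"
  using frag_extend_fun_add [of "\<lambda>s. f s - g s" g x] by simp

lemma augmentation_0 [simp]: "augmentation 0 = 0"
  by (simp add: augmentation_def)

lemma augmentation_frag_of [simp]: "augmentation (frag_of s) = 1"
  by (simp add: augmentation_def)

lemma augmentation_superset: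
  assumes "finite K" "Poly_Mapping.keys x \<subseteq> K"
  shows "augmentation x = (\<Sum>s\<in>K. Poly_Mapping.lookup x s)"
  unfolding augmentation_def using assms
  by (intro sum.mono_neutral_left) (auto simp: in_keys_iff)

lemma augmentation_add: "augmentation (x + y) = augmentation x + augmentation y"
proof -
  let ?K = "Poly_Mapping.keys x \<union> Poly_Mapping.keys y"
  have "Poly_Mapping.keys (x + y) \<subseteq> ?K" by (rule keys_add)
  then show ?thesis
    by (simp add: augmentation_superset [of ?K] lookup_add sum.distrib)
qed

lemma augmentation_diff: "augmentation (x - y) = augmentation x - augmentation y"
  using augmentation_add [of "x - y" y] by simp

context monoid
begin

lemma monoid_ring_mult_closed:
  assumes "Poly_Mapping.keys x \<subseteq> carrier G" "Poly_Mapping.keys y \<subseteq> carrier G"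
  shows "Poly_Mapping.keys (x \<otimes>\<^bsub>monoid_ring G\<^esub> y) \<subseteq> carrier G"
proof -
  have "Poly_Mapping.keys (frag_extend (\<lambda>t. frag_of (s \<otimes> t)) y) \<subseteq> carrier G"
    if "s \<in> Poly_Mapping.keys x" for s
    using keys_frag_extend [of "\<lambda>t. frag_of (s \<otimes> t)" y] assms that
    by fastforce
  then show ?thesis
    using keys_frag_extend [of "\<lambda>s. frag_extend (\<lambda>t. frag_of (s \<otimes> t)) y" x] by fastforce
qed

lemma monoid_ring_mult_assoc:
  assumes "Poly_Mapping.keys x \<subseteq> carrier G" "Poly_Mapping.keys y \<subseteq> carrier G"
    "Poly_Mapping.keys z \<subseteq> carrier G"
  shows "(x \<otimes>\<^bsub>monoid_ring G\<^esub> y) \<otimes>\<^bsub>monoid_ring G\<^esub> z = x \<otimes>\<^bsub>monoid_ring G\<^esub> (y \<otimes>\<^bsub>monoid_ring G\<^esub> z)"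
  using assms(1)
proof (induction x rule: frag_induction)
  case zero
  show ?case by simp
next
  case (one s)
  show ?case
    using assms(2)
  proof (induction y rule: frag_induction)
    case zero
    show ?case by simp
  next
    case (one t)
    show ?case
      using assms(3)
    proof (induction z rule: frag_induction)
      case (one u)
      then show ?case
        using \<open>s \<in> carrier G\<close> \<open>t \<in> carrier G\<close> by (simp add: m_assoc)
    qed (simp_all add: frag_extend_diff frag_extend_fun_diff)
  qed (simp_all add: frag_extend_diff frag_extend_fun_diff)
qed (simp_all add: frag_extend_diff frag_extend_fun_diff)

lemma ring_monoid_ring: "ring (monoid_ring G)"
proof (rule ringI)
  show "abelian_group (monoid_ring G)"
  proof (rule abelian_groupI)
    fix x assume "x \<in> carrier (monoid_ring G)"
    then show "\<exists>y\<in>carrier (monoid_ring G). y \<oplus>\<^bsub>monoid_ring G\<^esub> x = \<zero>\<^bsub>monoid_ring G\<^esub>"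
      by (intro bexI [of _ "- x"]) auto
  next
    fix x y assume "x \<in> carrier (monoid_ring G)" "y \<in> carrier (monoid_ring G)"
    then show "x \<oplus>\<^bsub>monoid_ring G\<^esub> y \<in> carrier (monoid_ring G)"
      using keys_add [of x y] by auto
  qed (simp_all add: ac_simps)
  show "monoid (monoid_ring G)"
  proof (rule monoidI)
    fix x assume "x \<in> carrier (monoid_ring G)"
    then have x: "Poly_Mapping.keys x \<subseteq> carrier G" by simp
    then show "\<one>\<^bsub>monoid_ring G\<^esub> \<otimes>\<^bsub>monoid_ring G\<^esub> x = x"
      by (induction x rule: frag_induction) (simp_all add: frag_extend_diff)
    show "x \<otimes>\<^bsub>monoid_ring G\<^esub> \<one>\<^bsub>monoid_ring G\<^esub> = x"
      using x by (induction x rule: frag_induction) (simp_all add: frag_extend_diff)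
  next
    fix x y assume "x \<in> carrier (monoid_ring G)" "y \<in> carrier (monoid_ring G)"
    then show "x \<otimes>\<^bsub>monoid_ring G\<^esub> y \<in> carrier (monoid_ring G)"
      using monoid_ring_mult_closed [of x y] by simp
  next
    fix x y z
    assume "x \<in> carrier (monoid_ring G)" "y \<in> carrier (monoid_ring G)" "z \<in> carrier (monoid_ring G)"
    then show "x \<otimes>\<^bsub>monoid_ring G\<^esub> y \<otimes>\<^bsub>monoid_ring G\<^esub> z = x \<otimes>\<^bsub>monoid_ring G\<^esub> (y \<otimes>\<^bsub>monoid_ring G\<^esub> z)"
      using monoid_ring_mult_assoc [of x y z] by simp
  qed simp
qed (simp_all add: frag_extend_add frag_extend_fun_add)

lemma augmentation_mult:
  "augmentation (x \<otimes>\<^bsub>monoid_ring G\<^esub> y) = augmentation x * augmentation y"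
  using subset_UNIV [of "Poly_Mapping.keys x"]
proof (induction x rule: frag_induction)
  case (one s)
  show ?case
    using subset_UNIV [of "Poly_Mapping.keys y"]
    by (induction y rule: frag_induction)
      (simp_all add: frag_extend_diff augmentation_diff)
qed (simp_all add: frag_extend_diff augmentation_diff left_diff_distrib)

lemma left_module_trivial_module: "left_module (monoid_ring G) trivial_module"
proof (intro left_module.intro left_module_axioms.intro)
  show "ring (monoid_ring G)" by (rule ring_monoid_ring)
  show "abelian_group trivial_module"
    by (rule abelian_groupI) (auto intro: exI [of _ "- _"])
  fix a b :: "'a \<Rightarrow>\<^sub>0 int" and k :: int
  show "(a \<otimes>\<^bsub>monoid_ring G\<^esub> b) \<odot>\<^bsub>trivial_module\<^esub> k =
      a \<odot>\<^bsub>trivial_module\<^esub> (b \<odot>\<^bsub>trivial_module\<^esub> k)"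
    using augmentation_mult [of a b] by simp
qed (simp_all add: augmentation_add algebra_simps)

end


subsection \<open>Independence of the type of the modules\<close>

definition module_image :: "('m \<Rightarrow> 'n) \<Rightarrow> ('r, 'm, 'q) module_scheme \<Rightarrow> ('r, 'n) module"
  where "module_image f M = (let g = inv_into (carrier M) f in
    \<lparr> carrier = f ` carrier M,
      monoid.mult = (\<lambda>x y. f (g x \<otimes>\<^bsub>M\<^esub> g y)),
      one = f \<one>\<^bsub>M\<^esub>,
      zero = f \<zero>\<^bsub>M\<^esub>,
      add = (\<lambda>x y. f (g x \<oplus>\<^bsub>M\<^esub> g y)),
      smult = (\<lambda>r x. f (r \<odot>\<^bsub>M\<^esub> g x)) \<rparr>)"

lemma module_image_simps:
  "carrier (module_image f M) = f ` carrier M"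
  "\<zero>\<^bsub>module_image f M\<^esub> = f \<zero>\<^bsub>M\<^esub>"
  "inj_on f (carrier M) \<Longrightarrow> x \<in> carrier M \<Longrightarrow> y \<in> carrier M \<Longrightarrow>
    f x \<oplus>\<^bsub>module_image f M\<^esub> f y = f (x \<oplus>\<^bsub>M\<^esub> y)"
  "inj_on f (carrier M) \<Longrightarrow> x \<in> carrier M \<Longrightarrow> r \<odot>\<^bsub>module_image f M\<^esub> f x = f (r \<odot>\<^bsub>M\<^esub> x)"
  by (simp_all add: module_image_def Let_def)

lemma left_module_module_image:
  assumes "left_module R M" and inj: "inj_on f (carrier M)"
  shows "left_module R (module_image f M)"
proof -
  interpret left_module R M by fact
  note s = module_image_simps(1,2) module_image_simps(3,4) [OF inj]
  show ?thesis
  proof (intro left_module.intro left_module_axioms.intro)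
    show "abelian_group (module_image f M)"
    proof (rule abelian_groupI)
      fix x assume "x \<in> carrier (module_image f M)"
      then obtain u where u: "u \<in> carrier M" "x = f u" by (auto simp: s)
      then show "\<exists>y\<in>carrier (module_image f M). y \<oplus>\<^bsub>module_image f M\<^esub> x = \<zero>\<^bsub>module_image f M\<^esub>"
        by (intro bexI [of _ "f (\<ominus>\<^bsub>M\<^esub> u)"]) (auto simp: s M.l_neg)
    qed (auto simp: s M.a_ac)
  qed (auto simp: s R.ring_axioms smult_l_distr smult_r_distr smult_assoc1)
qed

lemma finsum_module_image:
  assumes "left_module R M" and inj: "inj_on f (carrier M)"
    and "finite B" "B \<subseteq> carrier M" "c \<in> f ` B \<rightarrow> carrier R"
  shows "(\<Oplus>\<^bsub>module_image f M\<^esub>b\<in>f ` B. c b \<odot>\<^bsub>module_image f M\<^esub> b) = f (\<Oplus>\<^bsub>M\<^esub>b\<in>B. c (f b) \<odot>\<^bsub>M\<^esub> b)"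
proof -
  interpret left_module R M by fact
  interpret N: left_module R "module_image f M"
    by (rule left_module_module_image [OF assms(1,2)])
  note s = module_image_simps(1,2) module_image_simps(3,4) [OF inj]
  show ?thesis
    using assms(3-5)
  proof (induction B rule: finite_induct)
    case empty
    then show ?case by (simp add: s)
  next
    case (insert a B)
    then have a: "a \<in> carrier M" "B \<subseteq> carrier M" "c (f a) \<in> carrier R" "c \<in> f ` B \<rightarrow> carrier R"
      by auto
    have na: "f a \<notin> f ` B"
      using insert.hyps a inj by (auto dest: inj_onD)
    have fB: "f b \<in> carrier (module_image f M)" if "b \<in> insert a B" for b
      using that a by (auto simp: module_image_simps(1))
    have cl: "(\<lambda>b. c b \<odot>\<^bsub>module_image f M\<^esub> b) \<in> f ` B \<rightarrow> carrier (module_image f M)"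
      using a fB by (intro Pi_I N.smult_closed) auto
    have cl': "(\<lambda>b. c (f b) \<odot>\<^bsub>M\<^esub> b) \<in> B \<rightarrow> carrier M"
      using a by auto
    have ca: "c (f a) \<odot>\<^bsub>module_image f M\<^esub> f a \<in> carrier (module_image f M)"
      using a fB by (intro N.smult_closed) auto
    have "(\<Oplus>\<^bsub>module_image f M\<^esub>b\<in>f ` insert a B. c b \<odot>\<^bsub>module_image f M\<^esub> b) =
        c (f a) \<odot>\<^bsub>module_image f M\<^esub> f a \<oplus>\<^bsub>module_image f M\<^esub>
        (\<Oplus>\<^bsub>module_image f M\<^esub>b\<in>f ` B. c b \<odot>\<^bsub>module_image f M\<^esub> b)"
      unfolding image_insert using insert.hyps na cl ca by (intro N.finsum_insert) auto
    also have "\<dots> = f (c (f a) \<odot>\<^bsub>M\<^esub> a \<oplus>\<^bsub>M\<^esub> (\<Oplus>\<^bsub>M\<^esub>b\<in>B. c (f b) \<odot>\<^bsub>M\<^esub> b))"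
      using insert.IH [OF a(2,4)] a M.finsum_closed [OF cl'] by (simp add: s)
    also have "c (f a) \<odot>\<^bsub>M\<^esub> a \<oplus>\<^bsub>M\<^esub> (\<Oplus>\<^bsub>M\<^esub>b\<in>B. c (f b) \<odot>\<^bsub>M\<^esub> b) =
        (\<Oplus>\<^bsub>M\<^esub>b\<in>insert a B. c (f b) \<odot>\<^bsub>M\<^esub> b)"
      using insert.hyps cl' a by (intro M.finsum_insert [symmetric]) auto
    finally show ?case .
  qed
qed

lemma fg_free_module_module_image:
  assumes "fg_free_module R M" and inj: "inj_on f (carrier M)"
  shows "fg_free_module R (module_image f M)"
proof -
  obtain B where lm: "left_module R M" and basis: "finite_module_basis R M B"
    using assms(1) unfolding fg_free_module_def by blast
  then have B: "finite B" "B \<subseteq> carrier M"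
    unfolding finite_module_basis_def by blast+
  have ex1: "\<exists>!c. c \<in> B \<rightarrow>\<^sub>E carrier R \<and> x = (\<Oplus>\<^bsub>M\<^esub>b\<in>B. c b \<odot>\<^bsub>M\<^esub> b)"
    if "x \<in> carrier M" for x
    using basis that unfolding finite_module_basis_def by (elim conjE) (drule bspec)
  interpret left_module R M by fact
  have injB: "inj_on f B" using inj B by (blast intro: inj_on_subset)
  have closed: "(\<Oplus>\<^bsub>M\<^esub>b\<in>B. c b \<odot>\<^bsub>M\<^esub> b) \<in> carrier M" if "c \<in> B \<rightarrow> carrier R" for c
    using that B by (intro M.finsum_closed) auto
  have "\<exists>!c. c \<in> f ` B \<rightarrow>\<^sub>E carrier R \<and>
      f x = (\<Oplus>\<^bsub>module_image f M\<^esub>b\<in>f ` B. c b \<odot>\<^bsub>module_image f M\<^esub> b)"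
    if x: "x \<in> carrier M" for x
  proof -
    obtain c where c: "c \<in> B \<rightarrow>\<^sub>E carrier R" "x = (\<Oplus>\<^bsub>M\<^esub>b\<in>B. c b \<odot>\<^bsub>M\<^esub> b)"
      and uniq: "\<And>c'. c' \<in> B \<rightarrow>\<^sub>E carrier R \<Longrightarrow> x = (\<Oplus>\<^bsub>M\<^esub>b\<in>B. c' b \<odot>\<^bsub>M\<^esub> b) \<Longrightarrow> c' = c"
      using ex1 [OF x] by (elim ex1E) blast
    let ?c = "restrict (c \<circ> inv_into B f) (f ` B)"
    have c': "?c \<in> f ` B \<rightarrow>\<^sub>E carrier R" using c injB by auto
    show ?thesis
    proof (rule ex1I)
      from c' have cR: "?c \<in> f ` B \<rightarrow> carrier R"
        unfolding PiE_def by (rule IntD1)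
      have "(\<Oplus>\<^bsub>M\<^esub>b\<in>B. ?c (f b) \<odot>\<^bsub>M\<^esub> b) = x"
        unfolding c(2) using c injB B by (intro M.finsum_cong') auto
      then have "f x = (\<Oplus>\<^bsub>module_image f M\<^esub>b\<in>f ` B. ?c b \<odot>\<^bsub>module_image f M\<^esub> b)"
        by (simp only: finsum_module_image [OF lm inj B cR])
      with c' show "?c \<in> f ` B \<rightarrow>\<^sub>E carrier R \<and>
          f x = (\<Oplus>\<^bsub>module_image f M\<^esub>b\<in>f ` B. ?c b \<odot>\<^bsub>module_image f M\<^esub> b)"
        by (rule conjI)
    next
      fix k assume k: "k \<in> f ` B \<rightarrow>\<^sub>E carrier R \<and>
          f x = (\<Oplus>\<^bsub>module_image f M\<^esub>b\<in>f ` B. k b \<odot>\<^bsub>module_image f M\<^esub> b)"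
      then have kE: "k \<in> f ` B \<rightarrow>\<^sub>E carrier R" by (rule conjunct1)
      then have kR: "k \<in> f ` B \<rightarrow> carrier R"
        unfolding PiE_def by (rule IntD1)
      let ?k = "restrict (k \<circ> f) B"
      have "f x = f (\<Oplus>\<^bsub>M\<^esub>b\<in>B. k (f b) \<odot>\<^bsub>M\<^esub> b)"
        using k finsum_module_image [OF lm inj B kR] by metis
      moreover have "(\<Oplus>\<^bsub>M\<^esub>b\<in>B. k (f b) \<odot>\<^bsub>M\<^esub> b) \<in> carrier M"
        using kR by (intro closed) auto
      ultimately have "x = (\<Oplus>\<^bsub>M\<^esub>b\<in>B. k (f b) \<odot>\<^bsub>M\<^esub> b)"
        using x inj by (meson inj_onD)
      also have "\<dots> = (\<Oplus>\<^bsub>M\<^esub>b\<in>B. ?k b \<odot>\<^bsub>M\<^esub> b)"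
        using kR B by (intro M.finsum_cong' refl Pi_I smult_closed) auto
      finally have "?k = c" using kR by (intro uniq) auto
      then have kc: "k (f b) = c b" if "b \<in> B" for b
        using that by (metis comp_apply restrict_apply')
      show "k = ?c"
      proof (rule PiE_ext [OF kE c'])
        fix y assume "y \<in> f ` B"
        then obtain b where b: "b \<in> B" "y = f b" by blast
        then show "k y = ?c y" using kc injB by simp
      qed
    qed
  qed
  then have "finite_module_basis R (module_image f M) (f ` B)"
    unfolding finite_module_basis_def module_image_simps(1)
    by (intro conjI finite_imageI image_mono B) (simp only: ball_simps, rule ballI)
  then show ?thesis
    unfolding fg_free_module_def by (intro conjI exI left_module_module_image [OF lm inj])
qed

lemma fg_free_module_embed:
  fixes M :: "('r, 'm, 'q) module_scheme"
  assumes "fg_free_module R M"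
  obtains f :: "'m \<Rightarrow> nat \<Rightarrow> 'r" where "inj_on f (carrier M)"
proof -
  obtain B where basis: "finite_module_basis R M B"
    using assms unfolding fg_free_module_def by blast
  then have "finite B" unfolding finite_module_basis_def by blast
  obtain h :: "nat \<Rightarrow> 'm" where h: "B \<subseteq> range h"
    using \<open>finite B\<close>
    by (metis countable_finite from_nat_into_surj subsetI rangeI)
  obtain c where cE: "\<And>x. x \<in> carrier M \<Longrightarrow> c x \<in> B \<rightarrow>\<^sub>E carrier R"
    and c: "\<And>x. x \<in> carrier M \<Longrightarrow> x = (\<Oplus>\<^bsub>M\<^esub>b\<in>B. c x b \<odot>\<^bsub>M\<^esub> b)"
    using basis unfolding finite_module_basis_def by metis
  have "inj_on (\<lambda>x. c x \<circ> h) (carrier M)"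
  proof (rule inj_onI)
    fix x y assume xy: "x \<in> carrier M" "y \<in> carrier M" "c x \<circ> h = c y \<circ> h"
    have "c x b = c y b" for b
    proof (cases "b \<in> B")
      case True
      then show ?thesis using h xy(3) by (metis comp_apply rangeE subsetD)
    next
      case False
      then show ?thesis using PiE_arb [OF cE] xy(1,2) by metis
    qed
    then have "c x = c y" by blast
    then show "x = y" using c [OF xy(1)] c [OF xy(2)] by metis
  qed
  then show ?thesis by (rule that)
qed

lemma left_FP_if_resolution:
  assumes "free_partial_resolution n S A d \<epsilon>"
  shows "left_FP n S"
proof -
  let ?R = "monoid_ring S" and ?Z = "trivial_module :: ('a \<Rightarrow>\<^sub>0 int, int) module"
  have free: "\<And>i. i \<le> n \<Longrightarrow> fg_free_module ?R (A i)"
    and d: "\<And>i. i < n \<Longrightarrow> d i \<in> left_module_hom ?R (A (Suc i)) (A i)"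
    and \<epsilon>: "\<epsilon> \<in> left_module_hom ?R (A 0) ?Z"
    and ex: "\<epsilon> ` carrier (A 0) = carrier ?Z"
      "0 < n \<Longrightarrow> d 0 ` carrier (A 1) = a_kernel (A 0) ?Z \<epsilon>"
      "\<And>i. Suc i < n \<Longrightarrow> d (Suc i) ` carrier (A (Suc (Suc i))) = a_kernel (A (Suc i)) (A i) (d i)"
    using assms unfolding free_partial_resolution_def by blast+
  have "\<forall>i. \<exists>f :: _ \<Rightarrow> nat \<Rightarrow> 'a \<Rightarrow>\<^sub>0 int. i \<le> n \<longrightarrow> inj_on f (carrier (A i))"
    using free fg_free_module_embed by metis
  then obtain f :: "nat \<Rightarrow> _ \<Rightarrow> nat \<Rightarrow> 'a \<Rightarrow>\<^sub>0 int"
    where inj: "\<And>i. i \<le> n \<Longrightarrow> inj_on (f i) (carrier (A i))"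
    by metis
  define g where "g i = inv_into (carrier (A i)) (f i)" for i
  have gf [simp]: "g i (f i x) = x" if "i \<le> n" "x \<in> carrier (A i)" for i x
    using inj that by (simp add: g_def)
  define A' where "A' i = module_image (f i) (A i)" for i
  define d' where "d' i = f i \<circ> d i \<circ> g (Suc i)" for i
  define \<epsilon>' where "\<epsilon>' = \<epsilon> \<circ> g 0"
  have lm: "left_module ?R (A i)" if "i \<le> n" for i
    using free that by (simp add: fg_free_module_def)
  have zero: "\<zero>\<^bsub>A i\<^esub> \<in> carrier (A i)" if "i \<le> n" for i
  proof -
    interpret left_module ?R "A i" using that by (rule lm)
    show ?thesis by simp
  qed
  have add: "x \<oplus>\<^bsub>A i\<^esub> y \<in> carrier (A i)"
    if "i \<le> n" "x \<in> carrier (A i)" "y \<in> carrier (A i)" for i x y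
  proof -
    interpret left_module ?R "A i" using that(1) by (rule lm)
    show ?thesis using that by simp
  qed
  have smult: "r \<odot>\<^bsub>A i\<^esub> x \<in> carrier (A i)"
    if "i \<le> n" "r \<in> carrier ?R" "x \<in> carrier (A i)" for i r x
    using left_module.smult_closed [OF lm] that by blast
  have A' [simp]: "carrier (A' i) = f i ` carrier (A i)" "\<zero>\<^bsub>A' i\<^esub> = f i \<zero>\<^bsub>A i\<^esub>" for i
    by (simp_all add: A'_def module_image_simps)
  have A'_add: "f i x \<oplus>\<^bsub>A' i\<^esub> f i y = f i (x \<oplus>\<^bsub>A i\<^esub> y)"
    if "i \<le> n" "x \<in> carrier (A i)" "y \<in> carrier (A i)" for i x y
    using that inj by (simp add: A'_def module_image_simps)
  have A'_smult: "r \<odot>\<^bsub>A' i\<^esub> f i x = f i (r \<odot>\<^bsub>A i\<^esub> x)"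
    if "i \<le> n" "x \<in> carrier (A i)" for i r x
    using that inj by (simp add: A'_def module_image_simps)
  have dc: "d i x \<in> carrier (A i)" if "i < n" "x \<in> carrier (A (Suc i))" for i x
    using d [OF that(1)] that(2) by (auto simp: left_module_hom_def)
  have d'f: "d' i (f (Suc i) x) = f i (d i x)" if "i < n" "x \<in> carrier (A (Suc i))" for i x
    using that by (simp add: d'_def)
  have \<epsilon>'f: "\<epsilon>' (f 0 x) = \<epsilon> x" if "x \<in> carrier (A 0)" for x
    using that by (simp add: \<epsilon>'_def)
  have im: "d' i ` carrier (A' (Suc i)) = f i ` d i ` carrier (A (Suc i))" if "i < n" for i
    using d'f [OF that] by (auto simp: image_image cong: image_cong_simp)
  have "free_partial_resolution n S A' d' \<epsilon>'"
    unfolding free_partial_resolution_def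
  proof (intro conjI allI impI)
    show "fg_free_module ?R (A' i)" if "i \<le> n" for i
      unfolding A'_def using that free inj by (intro fg_free_module_module_image)
    show "d' i \<in> left_module_hom ?R (A' (Suc i)) (A' i)" if i: "i < n" for i
      using d [OF i] i add [of "Suc i"] smult [of "Suc i"] dc [OF i] d'f [OF i]
      by (auto simp: left_module_hom_def A'_add A'_smult simp del: monoid_ring_simps)
    show "\<epsilon>' \<in> left_module_hom ?R (A' 0) trivial_module"
      using \<epsilon> add [of 0] smult [of 0] \<epsilon>'f
      by (auto simp: left_module_hom_def A'_add A'_smult simp del: monoid_ring_simps)
    show "\<epsilon>' ` carrier (A' 0) = carrier ?Z"
      using ex(1) \<epsilon>'f by (auto simp: image_image cong: image_cong_simp)
    show "d' 0 ` carrier (A' 1) = a_kernel (A' 0) ?Z \<epsilon>'" if "0 < n"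
      using im [OF that] ex(2) [OF that] \<epsilon>'f by (auto simp: a_kernel_def')
    show "d' (Suc i) ` carrier (A' (Suc (Suc i))) = a_kernel (A' (Suc i)) (A' i) (d' i)"
      if i: "Suc i < n" for i
    proof -
      have "f i (d i x) = f i \<zero>\<^bsub>A i\<^esub> \<longleftrightarrow> d i x = \<zero>\<^bsub>A i\<^esub>" if "x \<in> carrier (A (Suc i))" for x
        using i that dc [of i x] zero [of i] inj [of i] by (auto dest: inj_onD)
      then show ?thesis
        using im [OF i] ex(3) [OF i] d'f [of i] i by (auto simp: a_kernel_def')
    qed
  qed
  then show ?thesis by (auto simp: left_FP_def)
qed

end

theory Submission
  imports Defs
begin

text \<open>
  The identity \<open>e\<close> of the ideal is a central idempotent of \<open>S\<close>: both \<open>s e\<close> and \<open>e s\<close> lie in the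
  ideal, so \<open>s e = e (s e) = (e s) e = e s\<close>. Hence \<open>e\<close> is a central idempotent of the ring
  \<open>R = \<int>S\<close>, and \<open>\<int>T\<close> is the corner \<open>e R\<close>, a direct factor of \<open>R\<close>. Moreover \<open>e\<close> acts on the
  trivial module as the identity, because its augmentation is \<open>1\<close>. The theorem is thus an instance of
  a statement about any ring \<open>R\<close>, any nonzero central idempotent \<open>e\<close> and any module \<open>Z\<close> with
  \<open>e Z = Z\<close>.

  From \<open>R\<close> to \<open>e R\<close>: the functor \<open>M \<mapsto> e M\<close> is exact, fixes \<open>Z\<close>, and sends a free module with
  basis \<open>B\<close> to a free module with basis \<open>e B\<close> (lemmas \<open>partial_resolution_corner\<close> and
  \<open>fg_free_corner\<close>).

  From \<open>e R\<close> to \<open>R\<close>: the modules of a free resolution over \<open>e R\<close> become \<open>R\<close>-modules through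
  \<open>r \<mapsto> e r\<close>. The maps and the exactness are unaffected, but the modules are now only projective:
  \<open>(e R)\<^sup>k\<close> is a retract of \<open>R\<^sup>k\<close> (lemma \<open>corner_free_retract\<close>). It remains to replace a resolution
  by retracts \<open>P\<^sub>i\<close> of finitely generated free modules \<open>F\<^sub>i\<close> by one that consists of finitely
  generated free modules (lemma \<open>free_resolution_of_retracts\<close>). If \<open>p\<^sub>i\<close> is the idempotent
  endomorphism of \<open>F\<^sub>i\<close> with image \<open>P\<^sub>i\<close>, then the periodic sequence
  \[ \cdots \to F_i \stackrel{p_i}{\to} F_i \stackrel{1 - p_i}{\to} F_i \to P_i \to 0 \]
  is exact. Splicing these sequences along the given resolution gives a complex whose module in
  degree \<open>i\<close> is \<open>F\<^sub>0 \<oplus> \<dots> \<oplus> F\<^sub>i\<close>, which is free of finite rank.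
\<close>

section \<open>Homomorphisms of modules\<close>

lemma left_module_homD:
  assumes "f \<in> left_module_hom R M N"
  shows "\<And>x. x \<in> carrier M \<Longrightarrow> f x \<in> carrier N"
    and "\<And>x y. x \<in> carrier M \<Longrightarrow> y \<in> carrier M \<Longrightarrow> f (x \<oplus>\<^bsub>M\<^esub> y) = f x \<oplus>\<^bsub>N\<^esub> f y"
    and "\<And>r x. r \<in> carrier R \<Longrightarrow> x \<in> carrier M \<Longrightarrow> f (r \<odot>\<^bsub>M\<^esub> x) = r \<odot>\<^bsub>N\<^esub> f x"
  using assms unfolding left_module_hom_def by blast+

lemma left_module_homI:
  assumes "\<And>x. x \<in> carrier M \<Longrightarrow> f x \<in> carrier N"
    and "\<And>x y. x \<in> carrier M \<Longrightarrow> y \<in> carrier M \<Longrightarrow> f (x \<oplus>\<^bsub>M\<^esub> y) = f x \<oplus>\<^bsub>N\<^esub> f y"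
    and "\<And>r x. r \<in> carrier R \<Longrightarrow> x \<in> carrier M \<Longrightarrow> f (r \<odot>\<^bsub>M\<^esub> x) = r \<odot>\<^bsub>N\<^esub> f x"
  shows "f \<in> left_module_hom R M N"
  using assms unfolding left_module_hom_def by blast

lemma additive_zero:
  assumes "abelian_group M" "abelian_group N" "\<And>x. x \<in> carrier M \<Longrightarrow> f x \<in> carrier N"
    and add: "\<And>x y. x \<in> carrier M \<Longrightarrow> y \<in> carrier M \<Longrightarrow> f (x \<oplus>\<^bsub>M\<^esub> y) = f x \<oplus>\<^bsub>N\<^esub> f y"
  shows "f \<zero>\<^bsub>M\<^esub> = \<zero>\<^bsub>N\<^esub>"
proof -
  interpret M: abelian_group M by fact
  interpret N: abelian_group N by fact
  have "f \<zero>\<^bsub>M\<^esub> \<oplus>\<^bsub>N\<^esub> f \<zero>\<^bsub>M\<^esub> = f \<zero>\<^bsub>M\<^esub>"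
    using add [of "\<zero>\<^bsub>M\<^esub>" "\<zero>\<^bsub>M\<^esub>"] by simp
  then show ?thesis
    using assms(3) [OF M.zero_closed] by (metis N.add.l_cancel_one')
qed

lemma additive_finsum:
  assumes "abelian_group M" "abelian_group N" and closed: "\<And>x. x \<in> carrier M \<Longrightarrow> f x \<in> carrier N"
    and add: "\<And>x y. x \<in> carrier M \<Longrightarrow> y \<in> carrier M \<Longrightarrow> f (x \<oplus>\<^bsub>M\<^esub> y) = f x \<oplus>\<^bsub>N\<^esub> f y"
    and "finite X" "g \<in> X \<rightarrow> carrier M"
  shows "f (\<Oplus>\<^bsub>M\<^esub>k\<in>X. g k) = (\<Oplus>\<^bsub>N\<^esub>k\<in>X. f (g k))"
proof -
  interpret M: abelian_group M by fact
  interpret N: abelian_group N by fact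
  show ?thesis
    using \<open>finite X\<close> \<open>g \<in> X \<rightarrow> carrier M\<close>
  proof (induction X rule: finite_induct)
    case empty
    show ?case
      using additive_zero [of M N f] assms by simp
  next
    case (insert k X)
    then have "g k \<in> carrier M" "g \<in> X \<rightarrow> carrier M" by auto
    moreover from this have "(\<lambda>k. f (g k)) \<in> X \<rightarrow> carrier N" "f (g k) \<in> carrier N"
      using closed by auto
    ultimately show ?case
      using insert by (simp add: add)
  qed
qed

lemma left_module_hom_zero:
  assumes "left_module R M" "left_module R N" "f \<in> left_module_hom R M N"
  shows "f \<zero>\<^bsub>M\<^esub> = \<zero>\<^bsub>N\<^esub>"
  using assms left_module_homD [OF assms(3)]
  by (intro additive_zero) (auto simp: left_module_def)

lemma left_module_hom_comp:
  assumes "f \<in> left_module_hom R M N" "g \<in> left_module_hom R N P"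
  shows "(\<lambda>x. g (f x)) \<in> left_module_hom R M P"
  using left_module_homD [OF assms(1)] left_module_homD [OF assms(2)]
  by (intro left_module_homI) auto

lemma left_module_hom_add:
  assumes "left_module R N" "f \<in> left_module_hom R M N" "g \<in> left_module_hom R M N"
  shows "(\<lambda>x. f x \<oplus>\<^bsub>N\<^esub> g x) \<in> left_module_hom R M N"
proof -
  interpret left_module R N by fact
  show ?thesis
    using left_module_homD [OF assms(2)] left_module_homD [OF assms(3)]
    by (intro left_module_homI) (auto simp: M.a_ac smult_r_distr)
qed

lemma left_module_smult_neg:
  assumes "left_module R N" "r \<in> carrier R" "x \<in> carrier N"
  shows "r \<odot>\<^bsub>N\<^esub> (\<ominus>\<^bsub>N\<^esub> x) = \<ominus>\<^bsub>N\<^esub> (r \<odot>\<^bsub>N\<^esub> x)"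
proof -
  interpret left_module R N by fact
  have "r \<odot>\<^bsub>N\<^esub> \<zero>\<^bsub>N\<^esub> = \<zero>\<^bsub>N\<^esub>"
    using additive_zero [of N N "\<lambda>x. r \<odot>\<^bsub>N\<^esub> x"] assms M.abelian_group_axioms
    by (simp add: smult_r_distr)
  then have "r \<odot>\<^bsub>N\<^esub> (\<ominus>\<^bsub>N\<^esub> x) \<oplus>\<^bsub>N\<^esub> r \<odot>\<^bsub>N\<^esub> x = \<zero>\<^bsub>N\<^esub>"
    using smult_r_distr [of r "\<ominus>\<^bsub>N\<^esub> x" x] assms by (simp add: M.l_neg)
  then show ?thesis
    using assms by (simp add: M.minus_equality)
qed

lemma left_module_hom_minus:
  assumes "left_module R N" "f \<in> left_module_hom R M N" "g \<in> left_module_hom R M N"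
  shows "(\<lambda>x. f x \<ominus>\<^bsub>N\<^esub> g x) \<in> left_module_hom R M N"
proof -
  interpret left_module R N by fact
  show ?thesis
    using left_module_homD [OF assms(2)] left_module_homD [OF assms(3)] left_module_smult_neg [OF assms(1)]
    by (intro left_module_homI) (auto simp: M.a_ac smult_r_distr M.minus_eq M.minus_add)
qed

lemma left_module_hom_ident: "(\<lambda>x. x) \<in> left_module_hom R M M"
  by (intro left_module_homI) simp_all

section \<open>Free modules of functions and their blocks\<close>

text \<open>A basis is a set, whereas the bases below come as families: the unit vectors of a function
  module, or the products \<open>e b\<close> of a basis with an idempotent. In a nontrivial ring the uniqueness of
  coefficients already makes such a family injective, since two equal members would have two different
  unit vectors as coefficients.\<close>

lemma finite_module_basis_indexed:
  assumes "left_module R M" and nontrivial: "\<one>\<^bsub>R\<^esub> \<noteq> \<zero>\<^bsub>R\<^esub>"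
    and X: "finite X" and h: "h \<in> X \<rightarrow> carrier M"
    and ex1: "\<And>x. x \<in> carrier M \<Longrightarrow>
      \<exists>!c. c \<in> X \<rightarrow>\<^sub>E carrier R \<and> x = (\<Oplus>\<^bsub>M\<^esub>k\<in>X. c k \<odot>\<^bsub>M\<^esub> h k)"
  shows "finite_module_basis R M (h ` X)"
proof -
  interpret left_module R M by fact
  have smult_zero: "\<zero>\<^bsub>R\<^esub> \<odot>\<^bsub>M\<^esub> x = \<zero>\<^bsub>M\<^esub>" if "x \<in> carrier M" for x
    using additive_zero [of R M "\<lambda>r. r \<odot>\<^bsub>M\<^esub> x"] that R.abelian_group_axioms M.abelian_group_axioms
    by (simp add: smult_l_distr)
  have inj: "inj_on h X"
  proof (rule inj_onI, rule ccontr)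
    fix k l assume kl: "k \<in> X" "l \<in> X" "h k = h l" "k \<noteq> l"
    define \<delta> where "\<delta> k = (\<lambda>i\<in>X. if k = i then \<one>\<^bsub>R\<^esub> else \<zero>\<^bsub>R\<^esub>)" for k
    have \<delta>E: "\<delta> k \<in> X \<rightarrow>\<^sub>E carrier R" for k
      by (auto simp: \<delta>_def)
    have sum: "(\<Oplus>\<^bsub>M\<^esub>i\<in>X. \<delta> k i \<odot>\<^bsub>M\<^esub> h i) = h k" if k: "k \<in> X" for k
    proof -
      have "(\<Oplus>\<^bsub>M\<^esub>i\<in>X. \<delta> k i \<odot>\<^bsub>M\<^esub> h i) = (\<Oplus>\<^bsub>M\<^esub>i\<in>X. if k = i then h i else \<zero>\<^bsub>M\<^esub>)"
        using h k by (intro M.finsum_cong') (auto simp: \<delta>_def smult_zero Pi_iff)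
      also have "\<dots> = h k"
        using M.finsum_singleton [of k X h] k X h by simp
      finally show ?thesis .
    qed
    have "\<exists>!c. c \<in> X \<rightarrow>\<^sub>E carrier R \<and> h k = (\<Oplus>\<^bsub>M\<^esub>i\<in>X. c i \<odot>\<^bsub>M\<^esub> h i)"
      using ex1 h kl by blast
    then have "\<delta> k = \<delta> l"
      using \<delta>E sum kl by metis
    then have "\<delta> k k = \<delta> l k" by simp
    then show False
      using kl nontrivial by (simp add: \<delta>_def)
  qed
  have reindex: "(\<Oplus>\<^bsub>M\<^esub>b\<in>h ` X. c b \<odot>\<^bsub>M\<^esub> b) = (\<Oplus>\<^bsub>M\<^esub>k\<in>X. restrict (c \<circ> h) X k \<odot>\<^bsub>M\<^esub> h k)"
    if c: "c \<in> h ` X \<rightarrow>\<^sub>E carrier R" for c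
  proof -
    have "(\<Oplus>\<^bsub>M\<^esub>b\<in>h ` X. c b \<odot>\<^bsub>M\<^esub> b) = (\<Oplus>\<^bsub>M\<^esub>k\<in>X. c (h k) \<odot>\<^bsub>M\<^esub> h k)"
      using inj h c by (intro M.finsum_reindex) (auto simp: PiE_iff Pi_iff)
    also have "\<dots> = (\<Oplus>\<^bsub>M\<^esub>k\<in>X. restrict (c \<circ> h) X k \<odot>\<^bsub>M\<^esub> h k)"
      using h c by (intro M.finsum_cong') (auto simp: PiE_iff Pi_iff)
    finally show ?thesis .
  qed
  have "\<exists>!c. c \<in> h ` X \<rightarrow>\<^sub>E carrier R \<and> x = (\<Oplus>\<^bsub>M\<^esub>b\<in>h ` X. c b \<odot>\<^bsub>M\<^esub> b)"
    if x: "x \<in> carrier M" for x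
  proof -
    obtain c where c: "c \<in> X \<rightarrow>\<^sub>E carrier R" "x = (\<Oplus>\<^bsub>M\<^esub>k\<in>X. c k \<odot>\<^bsub>M\<^esub> h k)"
      and uniq: "\<And>c'. c' \<in> X \<rightarrow>\<^sub>E carrier R \<Longrightarrow> x = (\<Oplus>\<^bsub>M\<^esub>k\<in>X. c' k \<odot>\<^bsub>M\<^esub> h k) \<Longrightarrow> c' = c"
      using ex1 [OF x] by (elim ex1E) blast
    define c' where "c' = restrict (c \<circ> inv_into X h) (h ` X)"
    have c'E: "c' \<in> h ` X \<rightarrow>\<^sub>E carrier R"
      using c inj by (auto simp: c'_def)
    have "restrict (c' \<circ> h) X = c"
      using c(1) inj by (intro PiE_ext [of _ X "\<lambda>_. carrier R" c]) (auto simp: c'_def)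
    then have sum: "x = (\<Oplus>\<^bsub>M\<^esub>b\<in>h ` X. c' b \<odot>\<^bsub>M\<^esub> b)"
      using reindex [OF c'E] c(2) by simp
    show ?thesis
    proof (rule ex1I [of _ c'])
      fix k assume k: "k \<in> h ` X \<rightarrow>\<^sub>E carrier R \<and> x = (\<Oplus>\<^bsub>M\<^esub>b\<in>h ` X. k b \<odot>\<^bsub>M\<^esub> b)"
      then have "restrict (k \<circ> h) X = c"
        using reindex [of k] by (intro uniq) auto
      then have "k (h i) = c' (h i)" if "i \<in> X" for i
        using that inj by (auto simp: c'_def)
      then show "k = c'"
        using k by (intro PiE_ext [OF _ c'E]) auto
    qed (use c'E sum in simp)
  qed
  then show ?thesis
    using X h unfolding finite_module_basis_def by blast
qed

definition free_module :: "('r, 'p) ring_scheme \<Rightarrow> 'k set \<Rightarrow> ('r, 'k \<Rightarrow> 'r) module"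
  where "free_module R X =
    \<lparr> carrier = X \<rightarrow>\<^sub>E carrier R,
      monoid.mult = (\<lambda>x y. \<lambda>k\<in>X. x k \<otimes>\<^bsub>R\<^esub> y k),
      one = (\<lambda>k\<in>X. \<one>\<^bsub>R\<^esub>),
      zero = (\<lambda>k\<in>X. \<zero>\<^bsub>R\<^esub>),
      add = (\<lambda>x y. \<lambda>k\<in>X. x k \<oplus>\<^bsub>R\<^esub> y k),
      smult = (\<lambda>r x. \<lambda>k\<in>X. r \<otimes>\<^bsub>R\<^esub> x k) \<rparr>"

lemma free_module_simps:
  "carrier (free_module R X) = X \<rightarrow>\<^sub>E carrier R"
  "\<zero>\<^bsub>free_module R X\<^esub> = (\<lambda>k\<in>X. \<zero>\<^bsub>R\<^esub>)"
  "x \<oplus>\<^bsub>free_module R X\<^esub> y = (\<lambda>k\<in>X. x k \<oplus>\<^bsub>R\<^esub> y k)"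
  "r \<odot>\<^bsub>free_module R X\<^esub> x = (\<lambda>k\<in>X. r \<otimes>\<^bsub>R\<^esub> x k)"
  by (simp_all add: free_module_def)

lemma left_module_free_module:
  assumes "ring R"
  shows "left_module R (free_module R X)"
proof -
  interpret ring R by fact
  have mem: "x k \<in> carrier R" if "x \<in> X \<rightarrow>\<^sub>E carrier R" "k \<in> X" for x k
    using that by auto
  have ext: "(\<lambda>k\<in>X. f k) = x" if "x \<in> X \<rightarrow>\<^sub>E carrier R" "\<And>k. k \<in> X \<Longrightarrow> f k = x k" for f x
    using that by (intro PiE_ext [of _ X "\<lambda>_. carrier R" x]) auto
  show ?thesis
  proof (intro left_module.intro left_module_axioms.intro)
    show "abelian_group (free_module R X)"
    proof (rule abelian_groupI)
      fix x assume x: "x \<in> carrier (free_module R X)"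
      then show "\<exists>y\<in>carrier (free_module R X). y \<oplus>\<^bsub>free_module R X\<^esub> x = \<zero>\<^bsub>free_module R X\<^esub>"
        by (intro bexI [of _ "\<lambda>k\<in>X. \<ominus>\<^bsub>R\<^esub> x k"])
          (auto simp: free_module_simps l_neg mem intro!: restrict_ext)
      show "\<zero>\<^bsub>free_module R X\<^esub> \<oplus>\<^bsub>free_module R X\<^esub> x = x"
        using x by (auto simp: free_module_simps mem intro!: ext)
    qed (auto simp: free_module_simps mem a_ac intro!: restrict_ext)
    show "\<one>\<^bsub>R\<^esub> \<odot>\<^bsub>free_module R X\<^esub> x = x" if "x \<in> carrier (free_module R X)" for x
      using that by (auto simp: free_module_simps mem intro!: ext)
  qed (auto simp: free_module_simps mem l_distr r_distr m_assoc ring_axioms intro!: restrict_ext)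
qed

lemma fg_free_free_module:
  assumes "ring R" "\<one>\<^bsub>R\<^esub> \<noteq> \<zero>\<^bsub>R\<^esub>" "finite X"
  shows "fg_free_module R (free_module R X)"
proof -
  interpret ring R by fact
  let ?F = "free_module R X"
  interpret F: left_module R ?F by (rule left_module_free_module) fact
  define \<delta> where "\<delta> i = (\<lambda>k\<in>X. if k = i then \<one>\<^bsub>R\<^esub> else \<zero>\<^bsub>R\<^esub>)" for i
  have \<delta>: "\<delta> \<in> X \<rightarrow> carrier ?F"
    by (auto simp: \<delta>_def free_module_simps)
  have expand: "(\<Oplus>\<^bsub>?F\<^esub>i\<in>X. c i \<odot>\<^bsub>?F\<^esub> \<delta> i) = c" if c: "c \<in> X \<rightarrow>\<^sub>E carrier R" for c
  proof (rule PiE_ext [of _ X "\<lambda>_. carrier R"])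
    have cF: "(\<lambda>i. c i \<odot>\<^bsub>?F\<^esub> \<delta> i) \<in> X \<rightarrow> carrier ?F"
      using c \<delta> by (intro Pi_I F.smult_closed) auto
    show "(\<Oplus>\<^bsub>?F\<^esub>i\<in>X. c i \<odot>\<^bsub>?F\<^esub> \<delta> i) \<in> X \<rightarrow>\<^sub>E carrier R"
      using F.M.finsum_closed [OF cF] by (simp add: free_module_simps)
    fix k assume k: "k \<in> X"
    have "(\<Oplus>\<^bsub>?F\<^esub>i\<in>X. c i \<odot>\<^bsub>?F\<^esub> \<delta> i) k = (\<Oplus>\<^bsub>R\<^esub>i\<in>X. (c i \<odot>\<^bsub>?F\<^esub> \<delta> i) k)"
      using additive_finsum [of ?F R "\<lambda>x. x k", OF _ _ _ _ \<open>finite X\<close> cF]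
        F.M.abelian_group_axioms abelian_group_axioms k
      by (auto simp: free_module_simps)
    also have "\<dots> = (\<Oplus>\<^bsub>R\<^esub>i\<in>X. if k = i then c i else \<zero>\<^bsub>R\<^esub>)"
      using k c by (intro finsum_cong') (auto simp: free_module_simps \<delta>_def PiE_iff)
    also have "\<dots> = c k"
      using finsum_singleton [of k X c] k c \<open>finite X\<close> by (auto simp: PiE_iff)
    finally show "(\<Oplus>\<^bsub>?F\<^esub>i\<in>X. c i \<odot>\<^bsub>?F\<^esub> \<delta> i) k = c k" .
  qed fact
  have "finite_module_basis R ?F (\<delta> ` X)"
  proof (rule finite_module_basis_indexed [OF F.left_module_axioms assms(2,3) \<delta>])
    fix x assume "x \<in> carrier ?F"
    then show "\<exists>!c. c \<in> X \<rightarrow>\<^sub>E carrier R \<and> x = (\<Oplus>\<^bsub>?F\<^esub>i\<in>X. c i \<odot>\<^bsub>?F\<^esub> \<delta> i)"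
      using expand by (intro ex1I [of _ x]) (auto simp: free_module_simps)
  qed
  then show ?thesis
    unfolding fg_free_module_def using F.left_module_axioms by blast
qed

text \<open>The free module on a disjoint union \<open>Sigma J B\<close> is the direct sum of the free modules on the
  \<open>B j\<close>: its elements are glued from blocks. Working with the single index set \<open>Sigma J B\<close> makes
  freeness of the direct sum immediate, and block-wise definitions still give homomorphisms.\<close>

definition block :: "(nat \<Rightarrow> 'k set) \<Rightarrow> nat \<Rightarrow> (nat \<times> 'k \<Rightarrow> 'r) \<Rightarrow> 'k \<Rightarrow> 'r"
  where "block B j x = (\<lambda>b\<in>B j. x (j, b))"

definition glue :: "nat set \<Rightarrow> (nat \<Rightarrow> 'k set) \<Rightarrow> (nat \<Rightarrow> 'k \<Rightarrow> 'r) \<Rightarrow> nat \<times> 'k \<Rightarrow> 'r"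
  where "glue J B f = (\<lambda>(j, b)\<in>Sigma J B. f j b)"

lemma block_hom:
  assumes "j \<in> J"
  shows "block B j \<in> left_module_hom R (free_module R (Sigma J B)) (free_module R (B j))"
  using assms by (intro left_module_homI) (auto simp: block_def free_module_simps)

lemma glue_hom:
  assumes "\<And>j. j \<in> J \<Longrightarrow> f j \<in> left_module_hom R M (free_module R (B j))"
  shows "(\<lambda>x. glue J B (\<lambda>j. f j x)) \<in> left_module_hom R M (free_module R (Sigma J B))"
proof -
  note f = left_module_homD [OF assms]
  show ?thesis
    using f(1)
    by (intro left_module_homI)
      (auto simp: glue_def free_module_simps f(2,3) PiE_iff extensional_def intro!: restrict_ext)
qed

lemma glue_closed:
  assumes "\<And>j. j \<in> J \<Longrightarrow> f j \<in> carrier (free_module R (B j))"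
  shows "glue J B f \<in> carrier (free_module R (Sigma J B))"
  using assms by (fastforce simp: glue_def free_module_simps PiE_iff)

lemma block_glue:
  assumes "j \<in> J" "f j \<in> carrier (free_module R (B j))"
  shows "block B j (glue J B f) = f j"
  using assms
  by (intro PiE_ext [of _ "B j" "\<lambda>_. carrier R"])
    (auto simp: block_def glue_def free_module_simps)

lemma free_module_block_eqI:
  assumes "x \<in> carrier (free_module R (Sigma J B))" "y \<in> carrier (free_module R (Sigma J B))"
    and "\<And>j. j \<in> J \<Longrightarrow> block B j x = block B j y"
  shows "x = y"
proof (rule PiE_ext)
  show "x \<in> Sigma J B \<rightarrow>\<^sub>E carrier R" "y \<in> Sigma J B \<rightarrow>\<^sub>E carrier R"
    using assms by (auto simp: free_module_simps)
  fix k assume "k \<in> Sigma J B"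
  then obtain j b where "k = (j, b)" "j \<in> J" "b \<in> B j" by blast
  then show "x k = y k"
    using fun_cong [OF assms(3), of j b] by (simp add: block_def)
qed

section \<open>From projective to free resolutions\<close>

text \<open>\<^const>\<open>free_partial_resolution\<close> without freeness, over any ring and for any resolved module, so
  that it also covers the projective resolutions that arise on the way.\<close>

definition partial_resolution ::
    "('r, 'p) ring_scheme \<Rightarrow> ('r, 'z) module \<Rightarrow> nat \<Rightarrow> (nat \<Rightarrow> ('r, 'm) module) \<Rightarrow>
     (nat \<Rightarrow> 'm \<Rightarrow> 'm) \<Rightarrow> ('m \<Rightarrow> 'z) \<Rightarrow> bool"
  where "partial_resolution R Z n A d \<epsilon> \<longleftrightarrow>
    (\<forall>i\<le>n. left_module R (A i)) \<and>
    (\<forall>i<n. d i \<in> left_module_hom R (A (Suc i)) (A i)) \<and>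
    \<epsilon> \<in> left_module_hom R (A 0) Z \<and>
    \<epsilon> ` carrier (A 0) = carrier Z \<and>
    (0 < n \<longrightarrow> d 0 ` carrier (A 1) = a_kernel (A 0) Z \<epsilon>) \<and>
    (\<forall>i. Suc i < n \<longrightarrow> d (Suc i) ` carrier (A (Suc (Suc i))) = a_kernel (A (Suc i)) (A i) (d i))"

lemma free_partial_resolution_iff:
  "free_partial_resolution n S A d \<epsilon> \<longleftrightarrow>
    partial_resolution (monoid_ring S) trivial_module n A d \<epsilon> \<and>
    (\<forall>i\<le>n. fg_free_module (monoid_ring S) (A i))"
proof -
  have "(\<forall>i\<le>n. fg_free_module (monoid_ring S) (A i)) \<longleftrightarrow>
      (\<forall>i\<le>n. left_module (monoid_ring S) (A i)) \<and> (\<forall>i\<le>n. fg_free_module (monoid_ring S) (A i))"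
    by (auto simp: fg_free_module_def)
  then show ?thesis
    unfolding free_partial_resolution_def partial_resolution_def by argo
qed

lemma partial_resolutionD:
  assumes "partial_resolution R Z n A d \<epsilon>"
  shows "\<And>i. i \<le> n \<Longrightarrow> left_module R (A i)"
    and "\<And>i. i < n \<Longrightarrow> d i \<in> left_module_hom R (A (Suc i)) (A i)"
    and "\<epsilon> \<in> left_module_hom R (A 0) Z"
    and "\<epsilon> ` carrier (A 0) = carrier Z"
    and "0 < n \<Longrightarrow> d 0 ` carrier (A (Suc 0)) = {x \<in> carrier (A 0). \<epsilon> x = \<zero>\<^bsub>Z\<^esub>}"
    and "\<And>i. Suc i < n \<Longrightarrow>
      d (Suc i) ` carrier (A (Suc (Suc i))) = {x \<in> carrier (A (Suc i)). d i x = \<zero>\<^bsub>A i\<^esub>}"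
  using assms unfolding partial_resolution_def a_kernel_def' One_nat_def by blast+

lemma partial_resolutionI:
  assumes "\<And>i. i \<le> n \<Longrightarrow> left_module R (A i)"
    and "\<And>i. i < n \<Longrightarrow> d i \<in> left_module_hom R (A (Suc i)) (A i)"
    and "\<epsilon> \<in> left_module_hom R (A 0) Z"
    and "\<epsilon> ` carrier (A 0) = carrier Z"
    and "0 < n \<Longrightarrow> d 0 ` carrier (A (Suc 0)) = {x \<in> carrier (A 0). \<epsilon> x = \<zero>\<^bsub>Z\<^esub>}"
    and "\<And>i. Suc i < n \<Longrightarrow>
      d (Suc i) ` carrier (A (Suc (Suc i))) = {x \<in> carrier (A (Suc i)). d i x = \<zero>\<^bsub>A i\<^esub>}"
  shows "partial_resolution R Z n A d \<epsilon>"
  using assms unfolding partial_resolution_def a_kernel_def' by simp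

text \<open>Each \<open>A i\<close> is a retract of a free module, hence projective; \<open>p i = \<kappa> i \<circ> \<pi> i\<close> is the idempotent
  that describes it. The block of index \<open>j\<close> in degree
  \<open>i \<ge> j\<close> belongs to the periodic resolution of \<open>A j\<close>, placed so that it starts in degree \<open>j\<close>. The
  top block of degree \<open>i + 1\<close> has no counterpart in degree \<open>i\<close>; it is mapped to the block of index \<open>i\<close>
  by \<open>\<kappa> i \<circ> d i \<circ> \<pi> (i + 1)\<close>. This map kills the image
  of the incoming \<open>1 - p (i + 1)\<close>, since \<open>\<pi> (i + 1) \<circ> p (i + 1) = \<pi> (i + 1)\<close>, so no correction terms
  between further blocks arise. A cycle \<open>x\<close> of degree \<open>i\<close> is lifted explicitly: \<open>\<pi> i\<close> sends its top
  block to \<open>d i y\<close> for some \<open>y\<close>, and \<open>x\<close> extended by the new top block \<open>\<kappa> (i + 1) y\<close> is a preimage.\<close>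

lemma free_resolution_of_retracts:
  fixes A :: "nat \<Rightarrow> ('r, 'm) module" and B :: "nat \<Rightarrow> 'k set"
  assumes "ring R" and res: "partial_resolution R Z n A d \<epsilon>"
    and \<pi>: "\<And>i. i \<le> n \<Longrightarrow> \<pi> i \<in> left_module_hom R (free_module R (B i)) (A i)"
    and \<kappa>: "\<And>i. i \<le> n \<Longrightarrow> \<kappa> i \<in> left_module_hom R (A i) (free_module R (B i))"
    and \<pi>\<kappa>: "\<And>i x. i \<le> n \<Longrightarrow> x \<in> carrier (A i) \<Longrightarrow> \<pi> i (\<kappa> i x) = x"
  shows "\<exists>D \<epsilon>'. partial_resolution R Z n (\<lambda>i. free_module R (Sigma {..i} B)) D \<epsilon>'"
proof -
  let ?F = "\<lambda>i. free_module R (B i)" and ?C = "\<lambda>i. free_module R (Sigma {..i} B)"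
  note A = partial_resolutionD(1) [OF res] and d = partial_resolutionD(2) [OF res]
    and \<epsilon> = partial_resolutionD(3) [OF res]
  have F: "left_module R (?F i)" and C: "left_module R (?C i)" for i
    by (rule left_module_free_module [OF \<open>ring R\<close>])+
  have \<epsilon>d: "\<epsilon> (d 0 y) = \<zero>\<^bsub>Z\<^esub>" if "0 < n" "y \<in> carrier (A (Suc 0))" for y
    using partial_resolutionD(5) [OF res] that by blast
  have ker_\<epsilon>: "\<exists>y\<in>carrier (A (Suc 0)). d 0 y = a"
    if "0 < n" "a \<in> carrier (A 0)" "\<epsilon> a = \<zero>\<^bsub>Z\<^esub>" for a
    using equalityD2 [OF partial_resolutionD(5) [OF res]] that by blast
  have dd: "d i (d (Suc i) y) = \<zero>\<^bsub>A i\<^esub>" if "Suc i < n" "y \<in> carrier (A (Suc (Suc i)))" for i y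
    using partial_resolutionD(6) [OF res] that by blast
  have ker_d: "\<exists>y\<in>carrier (A (Suc (Suc i))). d (Suc i) y = a"
    if "Suc i < n" "a \<in> carrier (A (Suc i))" "d i a = \<zero>\<^bsub>A i\<^esub>" for i a
    using equalityD2 [OF partial_resolutionD(6) [OF res]] that by blast
  define p where "p i x = \<kappa> i (\<pi> i x)" for i x
  define q where "q i x = x \<ominus>\<^bsub>?F i\<^esub> p i x" for i x
  have p_hom: "p i \<in> left_module_hom R (?F i) (?F i)" if "i \<le> n" for i
    unfolding p_def using left_module_hom_comp [OF \<pi> \<kappa>] that by blast
  have q_hom: "q i \<in> left_module_hom R (?F i) (?F i)" if "i \<le> n" for i
    unfolding q_def using left_module_hom_minus [OF F left_module_hom_ident p_hom] that by blast
  note [simp] = left_module_homD(1) [OF \<pi>] left_module_homD(1) [OF \<kappa>] left_module_homD(1) [OF d]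
    left_module_homD(1) [OF p_hom] left_module_homD(1) [OF q_hom] \<pi>\<kappa>
  have \<pi>0 [simp]: "\<pi> i \<zero>\<^bsub>?F i\<^esub> = \<zero>\<^bsub>A i\<^esub>" and \<kappa>0 [simp]: "\<kappa> i \<zero>\<^bsub>A i\<^esub> = \<zero>\<^bsub>?F i\<^esub>" if "i \<le> n" for i
    using left_module_hom_zero [OF F A \<pi>] left_module_hom_zero [OF A F \<kappa>] that by blast+
  have [simp]: "\<pi> i (p i x) = \<pi> i x" "p i (p i x) = p i x"
    if "i \<le> n" "x \<in> carrier (?F i)" for i x
    using that by (simp_all add: p_def)
  have qp: "q i x \<oplus>\<^bsub>?F i\<^esub> p i x = x" if "i \<le> n" "x \<in> carrier (?F i)" for i x
  proof -
    interpret F: left_module R "?F i" by (rule F)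
    show ?thesis
      using that by (simp add: q_def F.M.minus_eq F.M.a_assoc F.M.l_neg)
  qed
  have q_zero_iff: "q i x = \<zero>\<^bsub>?F i\<^esub> \<longleftrightarrow> p i x = x" if "i \<le> n" "x \<in> carrier (?F i)" for i x
  proof -
    interpret F: left_module R "?F i" by (rule F)
    have "p i x = x" if "q i x = \<zero>\<^bsub>?F i\<^esub>"
      using qp [OF \<open>i \<le> n\<close> \<open>x \<in> carrier (?F i)\<close>] that \<open>i \<le> n\<close> \<open>x \<in> carrier (?F i)\<close> by simp
    moreover have "q i x = \<zero>\<^bsub>?F i\<^esub>" if "p i x = x"
      using that \<open>x \<in> carrier (?F i)\<close> by (simp add: q_def F.M.minus_eq F.M.r_neg)
    ultimately show ?thesis by blast
  qed
  have q_fix: "q i x = x" if "i \<le> n" "x \<in> carrier (?F i)" "p i x = \<zero>\<^bsub>?F i\<^esub>" for i x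
  proof -
    interpret F: left_module R "?F i" by (rule F)
    show ?thesis
      using qp [OF that(1,2)] that by simp
  qed
  have \<pi>q [simp]: "\<pi> i (q i x) = \<zero>\<^bsub>A i\<^esub>" if "i \<le> n" "x \<in> carrier (?F i)" for i x
  proof -
    interpret A: left_module R "A i" using that by (intro A)
    have "\<pi> i (q i x) \<oplus>\<^bsub>A i\<^esub> \<pi> i (p i x) = \<pi> i x"
      using qp [OF that] that left_module_homD(2) [OF \<pi> [OF that(1)], of "q i x" "p i x"]
      by simp
    then show ?thesis
      using that by simp
  qed
  have pq [simp]: "p i (q i x) = \<zero>\<^bsub>?F i\<^esub>" "q i (p i x) = \<zero>\<^bsub>?F i\<^esub>"
    if "i \<le> n" "x \<in> carrier (?F i)" for i x
    using that by (simp_all add: p_def q_zero_iff)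

  \<comment> \<open>The differential of the periodic resolution of \<open>A j\<close> from degree \<open>i + 1\<close> to degree \<open>i\<close>. In the
    lowest degree \<open>i = j\<close> it has to be \<open>q j = 1 - p j\<close>, because \<open>q j\<close> maps onto the kernel of \<open>\<pi> j\<close>.\<close>
  define t where "t i j = (if even (i - j) then q j else p j)" for i j :: nat
  define D where "D i x = glue {..i} B (\<lambda>j.
    if j = i then q i (block B i x) \<oplus>\<^bsub>?F i\<^esub> \<kappa> i (d i (\<pi> (Suc i) (block B (Suc i) x)))
    else t i j (block B j x))" for i x
  define \<epsilon>' where "\<epsilon>' x = \<epsilon> (\<pi> 0 (block B 0 x))" for x
  have t_hom: "t i j \<in> left_module_hom R (?F j) (?F j)" if "j \<le> n" for i j
    using that p_hom q_hom by (simp add: t_def)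
  have block_hom': "block B j \<in> left_module_hom R (?C i) (?F j)" if "j \<le> i" for i j
    using that by (intro block_hom) simp
  have block_closed [simp]: "block B j x \<in> carrier (?F j)" if "x \<in> carrier (?C i)" "j \<le> i" for i j x
    using left_module_homD(1) [OF block_hom'] that by blast
  have D_hom: "D i \<in> left_module_hom R (?C (Suc i)) (?C i)" if i: "i < n" for i
    unfolding D_def
  proof (rule glue_hom)
    fix j assume "j \<in> {..i}"
    then have j: "j \<le> i" by simp
    show "(\<lambda>x. if j = i then q i (block B i x) \<oplus>\<^bsub>?F i\<^esub> \<kappa> i (d i (\<pi> (Suc i) (block B (Suc i) x)))
        else t i j (block B j x)) \<in> left_module_hom R (?C (Suc i)) (?F j)"
    proof (cases "j = i")
      case True
      have "(\<lambda>x. q i (block B i x)) \<in> left_module_hom R (?C (Suc i)) (?F i)"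
        using i by (intro left_module_hom_comp [OF block_hom' q_hom]) auto
      moreover have "(\<lambda>x. \<pi> (Suc i) (block B (Suc i) x)) \<in> left_module_hom R (?C (Suc i)) (A (Suc i))"
        using i by (intro left_module_hom_comp [OF block_hom' \<pi>]) auto
      then have "(\<lambda>x. \<kappa> i (d i (\<pi> (Suc i) (block B (Suc i) x))))
          \<in> left_module_hom R (?C (Suc i)) (?F i)"
        using i by (intro left_module_hom_comp [OF left_module_hom_comp [OF _ d] \<kappa>]) auto
      ultimately show ?thesis
        using True left_module_hom_add [OF F] by simp
    next
      case False
      then show ?thesis
        using i j left_module_hom_comp [OF block_hom' t_hom] by simp
    qed
  qed
  have D_closed: "D i x \<in> carrier (?C i)" if "i < n" "x \<in> carrier (?C (Suc i))" for i x
    using left_module_homD(1) [OF D_hom] that by blast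
  have block_D: "block B j (D i x) =
      (if j = i then q i (block B i x) \<oplus>\<^bsub>?F i\<^esub> \<kappa> i (d i (\<pi> (Suc i) (block B (Suc i) x)))
       else t i j (block B j x))" (is "_ = ?f j")
    if "i < n" "x \<in> carrier (?C (Suc i))" "j \<le> i" for i j x
  proof -
    interpret F: left_module R "?F i" by (rule F)
    have "?f j \<in> carrier (?F j)"
      using that left_module_homD(1) [OF t_hom] by simp
    then show ?thesis
      unfolding D_def using that by (intro block_glue [of j "{..i}" _ R B]) auto
  qed
  \<comment> \<open>On top blocks \<open>\<pi>\<close> is a chain map to the given resolution.\<close>
  have \<pi>_D: "\<pi> i (block B i (D i x)) = d i (\<pi> (Suc i) (block B (Suc i) x))"
    if "i < n" "x \<in> carrier (?C (Suc i))" for i x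
  proof -
    interpret A: left_module R "A i" using that by (intro A) simp
    show ?thesis
      using that left_module_homD(2) [OF \<pi>, of i] by (simp add: block_D)
  qed
  \<comment> \<open>The lower blocks of \<open>x\<close> are their own preimages by \<open>tx\<close>; in the top block, \<open>q\<close> recovers
    \<open>q i x\<close> from \<open>x\<close> itself and \<open>\<kappa> i (d i y)\<close> supplies the missing \<open>p i x\<close>.\<close>
  have lift: "\<exists>z\<in>carrier (?C (Suc i)). D i z = x"
    if i: "i < n" and x: "x \<in> carrier (?C i)" and y: "y \<in> carrier (A (Suc i))"
      and dy: "d i y = \<pi> i (block B i x)"
      and tx: "\<And>j. j < i \<Longrightarrow> t i j (block B j x) = block B j x"
    for i x y
  proof
    let ?f = "\<lambda>j. if j = Suc i then \<kappa> (Suc i) y else block B j x"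
    let ?z = "glue {..Suc i} B ?f"
    have f: "?f j \<in> carrier (?F j)" if "j \<le> Suc i" for j
      using that i x y by simp
    show z: "?z \<in> carrier (?C (Suc i))"
      using f by (intro glue_closed) simp
    have block_z: "block B j ?z = ?f j" if "j \<le> Suc i" for j
      using that f by (intro block_glue [of j "{..Suc i}" ?f R B]) auto
    have "\<kappa> i (\<pi> i (block B i x)) = p i (block B i x)"
      by (simp add: p_def)
    then show "D i ?z = x"
      using i x y z dy tx
      by (intro free_module_block_eqI [OF D_closed x]) (auto simp: block_D block_z qp)
  qed
  \<comment> \<open>Consecutive maps \<open>t\<close> are the complementary idempotents \<open>p j\<close> and \<open>q j\<close>.\<close>
  have t_fix: "t (Suc i) j x = x" if "t i j x = \<zero>\<^bsub>?F j\<^esub>" "j \<le> i" "j \<le> n" "x \<in> carrier (?F j)" for i j x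
    using that by (auto simp: t_def q_zero_iff q_fix Suc_diff_le split: if_splits)
  have t_t: "t i j (t (Suc i) j x) = \<zero>\<^bsub>?F j\<^esub>" if "j \<le> i" "j \<le> n" "x \<in> carrier (?F j)" for i j x
    using that by (auto simp: t_def Suc_diff_le)

  have "partial_resolution R Z n ?C D \<epsilon>'"
  proof (rule partial_resolutionI)
    have \<pi>_block: "(\<lambda>x. \<pi> 0 (block B 0 x)) \<in> left_module_hom R (?C 0) (A 0)"
      by (intro left_module_hom_comp [OF block_hom' \<pi>]) auto
    then show "\<epsilon>' \<in> left_module_hom R (?C 0) Z"
      unfolding \<epsilon>'_def by (rule left_module_hom_comp [OF _ \<epsilon>])
    show "\<epsilon>' ` carrier (?C 0) = carrier Z"
    proof (intro equalityI subsetI)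
      fix k assume "k \<in> carrier Z"
      then have "k \<in> \<epsilon> ` carrier (A 0)"
        by (simp only: partial_resolutionD(4) [OF res])
      then obtain a where a: "a \<in> carrier (A 0)" "\<epsilon> a = k"
        by blast
      let ?x = "glue {..0} B (\<lambda>_. \<kappa> 0 a)"
      have \<kappa>a: "\<kappa> 0 a \<in> carrier (?F j)" if "j \<in> {..0}" for j
        using a that by simp
      have x: "?x \<in> carrier (?C 0)"
        by (rule glue_closed) (rule \<kappa>a)
      have "block B 0 ?x = \<kappa> 0 a"
        by (rule block_glue [of 0 "{..0}" "\<lambda>_. \<kappa> 0 a" R B, OF _ \<kappa>a]) simp_all
      then have "k = \<epsilon>' ?x"
        using a by (simp add: \<epsilon>'_def)
      then show "k \<in> \<epsilon>' ` carrier (?C 0)"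
        using x by (rule image_eqI)
    next
      fix k assume "k \<in> \<epsilon>' ` carrier (?C 0)"
      then show "k \<in> carrier Z"
        using left_module_homD(1) [OF \<pi>_block] left_module_homD(1) [OF \<epsilon>] by (auto simp: \<epsilon>'_def)
    qed
    show "D 0 ` carrier (?C (Suc 0)) = {x \<in> carrier (?C 0). \<epsilon>' x = \<zero>\<^bsub>Z\<^esub>}" if n: "0 < n"
    proof (intro equalityI subsetI CollectI conjI)
      fix x assume "x \<in> D 0 ` carrier (?C (Suc 0))"
      then obtain z where z: "z \<in> carrier (?C (Suc 0))" "x = D 0 z" by blast
      show "x \<in> carrier (?C 0)"
        unfolding z(2) by (rule D_closed [OF n z(1)])
      have "\<pi> (Suc 0) (block B (Suc 0) z) \<in> carrier (A (Suc 0))"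
        using n z(1) by simp
      then show "\<epsilon>' x = \<zero>\<^bsub>Z\<^esub>"
        unfolding \<epsilon>'_def z(2) \<pi>_D [OF n z(1)] by (rule \<epsilon>d [OF n])
    next
      fix x assume "x \<in> {x \<in> carrier (?C 0). \<epsilon>' x = \<zero>\<^bsub>Z\<^esub>}"
      then have x: "x \<in> carrier (?C 0)" and "\<epsilon> (\<pi> 0 (block B 0 x)) = \<zero>\<^bsub>Z\<^esub>"
        by (simp_all only: \<epsilon>'_def mem_Collect_eq)
      moreover have "\<pi> 0 (block B 0 x) \<in> carrier (A 0)"
        using x by (rule left_module_homD(1) [OF \<pi>_block])
      ultimately obtain y where "y \<in> carrier (A (Suc 0))" "d 0 y = \<pi> 0 (block B 0 x)"
        using ker_\<epsilon> [OF n] by blast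
      from lift [OF n x this] show "x \<in> D 0 ` carrier (?C (Suc 0))"
        by blast
    qed
    show "D (Suc i) ` carrier (?C (Suc (Suc i))) = {x \<in> carrier (?C (Suc i)). D i x = \<zero>\<^bsub>?C i\<^esub>}"
      if i: "Suc i < n" for i
    proof (intro equalityI subsetI CollectI conjI)
      have i': "i < n" using i by simp
      fix x assume "x \<in> D (Suc i) ` carrier (?C (Suc (Suc i)))"
      then obtain z where z: "z \<in> carrier (?C (Suc (Suc i)))" "x = D (Suc i) z" by auto
      have x: "x \<in> carrier (?C (Suc i))"
        using z D_closed [OF i] by simp
      interpret C: left_module R "?C i" by (rule C)
      interpret F: left_module R "?F i" by (rule F)
      have "\<pi> (Suc (Suc i)) (block B (Suc (Suc i)) z) \<in> carrier (A (Suc (Suc i)))"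
        using i z(1) by simp
      then have dd: "d i (\<pi> (Suc i) (block B (Suc i) x)) = \<zero>\<^bsub>A i\<^esub>"
        unfolding z(2) \<pi>_D [OF i z(1)] by (rule dd [OF i])
      show "x \<in> carrier (?C (Suc i))" by (rule x)
      show "D i x = \<zero>\<^bsub>?C i\<^esub>"
      proof (rule free_module_block_eqI [OF D_closed [OF i' x] C.M.zero_closed])
        fix j assume "j \<in> {..i}"
        then have j: "j \<le> i" by simp
        have bx: "block B j x = t (Suc i) j (block B j z)"
          using i j z block_D [OF i z(1), of j] by simp
        have "block B j (D i x) = t i j (block B j x)"
          using i' j x dd by (auto simp: block_D t_def)
        also have "\<dots> = \<zero>\<^bsub>?F j\<^esub>"
          using i' j z(1) t_t by (simp add: bx)
        also have "\<dots> = block B j \<zero>\<^bsub>?C i\<^esub>"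
          using left_module_hom_zero [OF C F block_hom'] j by simp
        finally show "block B j (D i x) = block B j \<zero>\<^bsub>?C i\<^esub>" .
      qed
    next
      have i': "i < n" using i by simp
      fix x assume "x \<in> {x \<in> carrier (?C (Suc i)). D i x = \<zero>\<^bsub>?C i\<^esub>}"
      then have x: "x \<in> carrier (?C (Suc i))" and Dx: "D i x = \<zero>\<^bsub>?C i\<^esub>"
        by (simp_all only: mem_Collect_eq)
      have block_Dx: "block B j (D i x) = \<zero>\<^bsub>?F j\<^esub>" if "j \<le> i" for j
        using left_module_hom_zero [OF C F block_hom'] that by (simp add: Dx)
      interpret F: left_module R "?F i" by (rule F)
      have dx: "d i (\<pi> (Suc i) (block B (Suc i) x)) = \<zero>\<^bsub>A i\<^esub>"
        using \<pi>_D [OF i' x] block_Dx [of i] i' by simp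
      moreover have "\<pi> (Suc i) (block B (Suc i) x) \<in> carrier (A (Suc i))"
        using i x by simp
      ultimately obtain y
        where y: "y \<in> carrier (A (Suc (Suc i)))" "d (Suc i) y = \<pi> (Suc i) (block B (Suc i) x)"
        using ker_d [OF i] by blast
      have "t (Suc i) j (block B j x) = block B j x" if "j < Suc i" for j
      proof (rule t_fix)
        have "block B j (D i x) = t i j (block B j x)"
          using i' that x dx by (auto simp: block_D t_def)
        then show "t i j (block B j x) = \<zero>\<^bsub>?F j\<^esub>"
          using block_Dx [of j] that by simp
      qed (use that i x in auto)
      then show "x \<in> D (Suc i) ` carrier (?C (Suc (Suc i)))"
        using lift [OF i x y] by blast
    qed
  qed (use C D_hom in auto)
  then show ?thesis by blast
qed

section \<open>Central idempotents\<close>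

locale central_idempotent = ring R for R (structure) +
  fixes e
  assumes idem_closed [simp]: "e \<in> carrier R"
    and idem [simp]: "e \<otimes> e = e"
    and idem_nonzero: "e \<noteq> \<zero>"
    and central: "r \<in> carrier R \<Longrightarrow> r \<otimes> e = e \<otimes> r"

text \<open>Since \<open>e\<close> is idempotent, \<open>e R\<close> and \<open>e M\<close> are exactly the sets of elements that \<open>e\<close> fixes.
  Describing them in this way spares the choice of a representation \<open>e x\<close> of an element.\<close>

definition corner_ring :: "('r, 'p) ring_scheme \<Rightarrow> 'r \<Rightarrow> ('r, 'p) ring_scheme"
  where "corner_ring R e = R\<lparr>carrier := {r \<in> carrier R. e \<otimes>\<^bsub>R\<^esub> r = r}, one := e\<rparr>"

definition corner_module :: "('r, 'p) ring_scheme \<Rightarrow> 'r \<Rightarrow> ('r, 'm, 'q) module_scheme \<Rightarrow> ('r, 'm, 'q) module_scheme"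
  where "corner_module R e M = M\<lparr>carrier := {x \<in> carrier M. e \<odot>\<^bsub>M\<^esub> x = x}\<rparr>"

text \<open>Restriction of scalars along the ring homomorphism \<open>r \<mapsto> e r\<close> from \<open>R\<close> onto the corner.\<close>

definition inflate_module :: "('r, 'p) ring_scheme \<Rightarrow> 'r \<Rightarrow> ('r, 'm, 'q) module_scheme \<Rightarrow> ('r, 'm, 'q) module_scheme"
  where "inflate_module R e M = M\<lparr>smult := \<lambda>r x. (e \<otimes>\<^bsub>R\<^esub> r) \<odot>\<^bsub>M\<^esub> x\<rparr>"

lemma corner_ring_simps [simp]:
  "carrier (corner_ring R e) = {r \<in> carrier R. e \<otimes>\<^bsub>R\<^esub> r = r}"
  "\<one>\<^bsub>corner_ring R e\<^esub> = e"
  "\<zero>\<^bsub>corner_ring R e\<^esub> = \<zero>\<^bsub>R\<^esub>"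
  "x \<oplus>\<^bsub>corner_ring R e\<^esub> y = x \<oplus>\<^bsub>R\<^esub> y"
  "x \<otimes>\<^bsub>corner_ring R e\<^esub> y = x \<otimes>\<^bsub>R\<^esub> y"
  by (simp_all add: corner_ring_def)

lemma corner_module_simps [simp]:
  "carrier (corner_module R e M) = {x \<in> carrier M. e \<odot>\<^bsub>M\<^esub> x = x}"
  "\<zero>\<^bsub>corner_module R e M\<^esub> = \<zero>\<^bsub>M\<^esub>"
  "x \<oplus>\<^bsub>corner_module R e M\<^esub> y = x \<oplus>\<^bsub>M\<^esub> y"
  "r \<odot>\<^bsub>corner_module R e M\<^esub> x = r \<odot>\<^bsub>M\<^esub> x"
  by (simp_all add: corner_module_def)

lemma inflate_module_simps [simp]:
  "carrier (inflate_module R e M) = carrier M"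
  "\<zero>\<^bsub>inflate_module R e M\<^esub> = \<zero>\<^bsub>M\<^esub>"
  "x \<oplus>\<^bsub>inflate_module R e M\<^esub> y = x \<oplus>\<^bsub>M\<^esub> y"
  "r \<odot>\<^bsub>inflate_module R e M\<^esub> x = (e \<otimes>\<^bsub>R\<^esub> r) \<odot>\<^bsub>M\<^esub> x"
  by (simp_all add: inflate_module_def)

context central_idempotent
begin

lemma idem_absorb [simp]: "r \<in> carrier R \<Longrightarrow> e \<otimes> (e \<otimes> r) = e \<otimes> r"
  using m_assoc [of e e r] by simp

lemma central_assoc: "r \<in> carrier R \<Longrightarrow> s \<in> carrier R \<Longrightarrow> e \<otimes> (r \<otimes> s) = r \<otimes> (e \<otimes> s)"
  using m_assoc [of e r s] m_assoc [of r e s] central [of r] by simp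

lemma idem_mult_idem: "r \<in> carrier R \<Longrightarrow> s \<in> carrier R \<Longrightarrow> (e \<otimes> r) \<otimes> (e \<otimes> s) = e \<otimes> (r \<otimes> s)"
  using m_assoc [of e r "e \<otimes> s"] central_assoc [of r s, symmetric] by simp

lemma ring_corner_ring: "ring (corner_ring R e)"
proof (rule ringI)
  show "abelian_group (corner_ring R e)"
  proof (rule abelian_groupI)
    fix x assume x: "x \<in> carrier (corner_ring R e)"
    then show "\<exists>y\<in>carrier (corner_ring R e). y \<oplus>\<^bsub>corner_ring R e\<^esub> x = \<zero>\<^bsub>corner_ring R e\<^esub>"
      by (intro bexI [of _ "\<ominus> x"]) (auto simp: l_neg r_minus)
  qed (auto simp: r_distr a_ac)
  show "Group.monoid (corner_ring R e)"
  proof (rule monoidI)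
    fix x y assume "x \<in> carrier (corner_ring R e)" "y \<in> carrier (corner_ring R e)"
    then show "x \<otimes>\<^bsub>corner_ring R e\<^esub> y \<in> carrier (corner_ring R e)"
      using m_assoc [of e x y] by simp
  qed (auto simp: central m_assoc)
qed (auto simp: l_distr r_distr)

lemma left_module_inflate:
  assumes "left_module (corner_ring R e) M"
  shows "left_module R (inflate_module R e M)"
proof -
  interpret M: left_module "corner_ring R e" M by fact
  show ?thesis
  proof (intro left_module.intro left_module_axioms.intro)
    show "abelian_group (inflate_module R e M)"
    proof (rule abelian_groupI)
      fix x assume "x \<in> carrier (inflate_module R e M)"
      then show "\<exists>y\<in>carrier (inflate_module R e M). y \<oplus>\<^bsub>inflate_module R e M\<^esub> x = \<zero>\<^bsub>inflate_module R e M\<^esub>"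
        by (intro bexI [of _ "\<ominus>\<^bsub>M\<^esub> x"]) (simp_all add: M.M.l_neg)
    next
      fix x y assume xy: "x \<in> carrier (inflate_module R e M)" "y \<in> carrier (inflate_module R e M)"
      then show "x \<oplus>\<^bsub>inflate_module R e M\<^esub> y = y \<oplus>\<^bsub>inflate_module R e M\<^esub> x"
        by (simp add: M.M.a_comm)
      show "x \<oplus>\<^bsub>inflate_module R e M\<^esub> y \<oplus>\<^bsub>inflate_module R e M\<^esub> z =
          x \<oplus>\<^bsub>inflate_module R e M\<^esub> (y \<oplus>\<^bsub>inflate_module R e M\<^esub> z)"
        if "z \<in> carrier (inflate_module R e M)" for z
        using xy that by (simp add: M.M.a_assoc)
    qed simp_all
    show "(a \<otimes> b) \<odot>\<^bsub>inflate_module R e M\<^esub> x =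
        a \<odot>\<^bsub>inflate_module R e M\<^esub> (b \<odot>\<^bsub>inflate_module R e M\<^esub> x)"
      if "a \<in> carrier R" "b \<in> carrier R" "x \<in> carrier (inflate_module R e M)" for a b x
    proof -
      have "e \<otimes> (a \<otimes> b) = (e \<otimes> a) \<otimes> (e \<otimes> b)"
        using that by (simp add: idem_mult_idem)
      then show ?thesis
        using that M.smult_assoc1 [of "e \<otimes> a" "e \<otimes> b" x] by simp
    qed
  qed (use ring_axioms M.smult_closed M.smult_l_distr M.smult_r_distr M.smult_one in
      \<open>simp_all add: r_distr\<close>)
qed

lemma left_module_corner:
  assumes "left_module R M"
  shows "left_module (corner_ring R e) (corner_module R e M)"
proof -
  interpret M: left_module R M by fact
  have zero: "e \<odot>\<^bsub>M\<^esub> \<zero>\<^bsub>M\<^esub> = \<zero>\<^bsub>M\<^esub>"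
    using additive_zero [of M M "\<lambda>x. e \<odot>\<^bsub>M\<^esub> x"] M.M.abelian_group_axioms
    by (simp add: M.smult_r_distr)
  show ?thesis
  proof (intro left_module.intro left_module_axioms.intro ring_corner_ring)
    show "abelian_group (corner_module R e M)"
    proof (rule abelian_groupI)
      fix x assume "x \<in> carrier (corner_module R e M)"
      then show "\<exists>y\<in>carrier (corner_module R e M). y \<oplus>\<^bsub>corner_module R e M\<^esub> x = \<zero>\<^bsub>corner_module R e M\<^esub>"
        by (intro bexI [of _ "\<ominus>\<^bsub>M\<^esub> x"]) (auto simp: M.M.l_neg left_module_smult_neg [OF assms])
    qed (auto simp: zero M.smult_r_distr M.M.a_ac)
  qed (auto simp: M.smult_l_distr M.smult_r_distr M.smult_assoc1 simp flip: M.smult_assoc1)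
qed

text \<open>A free module over \<open>e R\<close> with basis \<open>B\<close> is the direct summand \<open>e F\<close> of the free \<open>R\<close>-module \<open>F\<close> on
  \<open>B\<close>: the inclusion \<open>\<kappa>\<close> takes coordinates, and the projection \<open>\<pi>\<close> multiplies all coefficients by \<open>e\<close>.\<close>

lemma corner_free_retract:
  fixes M :: "('a, 'm, 'q) module_scheme"
  assumes "fg_free_module (corner_ring R e) M"
  obtains B :: "'m set" and \<pi> \<kappa> where "finite B"
    and "\<pi> \<in> left_module_hom R (free_module R B) (inflate_module R e M)"
    and "\<kappa> \<in> left_module_hom R (inflate_module R e M) (free_module R B)"
    and "\<And>x. x \<in> carrier M \<Longrightarrow> \<pi> (\<kappa> x) = x"
proof -
  let ?C = "corner_ring R e"
  obtain B where "left_module ?C M" and basis: "finite_module_basis ?C M B"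
    using assms unfolding fg_free_module_def by blast
  interpret M: left_module ?C M by fact
  have B: "finite B" "B \<subseteq> carrier M"
    using basis unfolding finite_module_basis_def by blast+
  have ex1: "\<exists>!c. c \<in> B \<rightarrow>\<^sub>E carrier ?C \<and> x = (\<Oplus>\<^bsub>M\<^esub>b\<in>B. c b \<odot>\<^bsub>M\<^esub> b)"
    if "x \<in> carrier M" for x
    using basis that unfolding finite_module_basis_def by (elim conjE) (drule bspec)
  define \<pi> where "\<pi> c = (\<Oplus>\<^bsub>M\<^esub>b\<in>B. (e \<otimes> c b) \<odot>\<^bsub>M\<^esub> b)" for c
  define \<kappa> where "\<kappa> x = (THE c. c \<in> B \<rightarrow>\<^sub>E carrier ?C \<and> x = (\<Oplus>\<^bsub>M\<^esub>b\<in>B. c b \<odot>\<^bsub>M\<^esub> b))" for x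
  have \<kappa>_props: "\<kappa> x \<in> B \<rightarrow>\<^sub>E carrier ?C \<and> x = (\<Oplus>\<^bsub>M\<^esub>b\<in>B. \<kappa> x b \<odot>\<^bsub>M\<^esub> b)" if "x \<in> carrier M" for x
    unfolding \<kappa>_def using ex1 [OF that] by (rule theI')
  have \<kappa>_mem: "\<kappa> x b \<in> carrier R" "e \<otimes> \<kappa> x b = \<kappa> x b" if "x \<in> carrier M" "b \<in> B" for x b
    using PiE_mem [OF conjunct1 [OF \<kappa>_props [OF that(1)]] that(2)] by simp_all
  have terms: "(\<lambda>b. (e \<otimes> c b) \<odot>\<^bsub>M\<^esub> b) \<in> B \<rightarrow> carrier M" if "c \<in> B \<rightarrow>\<^sub>E carrier R" for c
    using B that by (intro Pi_I M.smult_closed) (auto simp: PiE_iff)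
  have \<pi>\<kappa>: "\<pi> (\<kappa> x) = x" if "x \<in> carrier M" for x
  proof -
    have "\<pi> (\<kappa> x) = (\<Oplus>\<^bsub>M\<^esub>b\<in>B. \<kappa> x b \<odot>\<^bsub>M\<^esub> b)"
      unfolding \<pi>_def using \<kappa>_mem [OF that] B
      by (intro M.M.finsum_cong' Pi_I M.smult_closed) auto
    then show ?thesis
      using \<kappa>_props [OF that] by simp
  qed
  have \<pi>_hom: "\<pi> \<in> left_module_hom R (free_module R B) (inflate_module R e M)"
  proof (rule left_module_homI)
    fix x assume "x \<in> carrier (free_module R B)"
    then have x: "x \<in> B \<rightarrow>\<^sub>E carrier R" by (simp add: free_module_simps)
    show "\<pi> x \<in> carrier (inflate_module R e M)"
      unfolding \<pi>_def using M.M.finsum_closed [OF terms [OF x]] by simp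
    show "\<pi> (x \<oplus>\<^bsub>free_module R B\<^esub> y) = \<pi> x \<oplus>\<^bsub>inflate_module R e M\<^esub> \<pi> y"
      if "y \<in> carrier (free_module R B)" for y
    proof -
      have y: "y \<in> B \<rightarrow>\<^sub>E carrier R" using that by (simp add: free_module_simps)
      have "\<pi> (x \<oplus>\<^bsub>free_module R B\<^esub> y) = (\<Oplus>\<^bsub>M\<^esub>b\<in>B. (e \<otimes> x b) \<odot>\<^bsub>M\<^esub> b \<oplus>\<^bsub>M\<^esub> (e \<otimes> y b) \<odot>\<^bsub>M\<^esub> b)"
        unfolding \<pi>_def
      proof (intro M.M.finsum_cong')
        fix b assume b: "b \<in> B"
        then have "b \<in> carrier M" "x b \<in> carrier R" "y b \<in> carrier R"
          using B x y by auto
        then show "(e \<otimes> (x \<oplus>\<^bsub>free_module R B\<^esub> y) b) \<odot>\<^bsub>M\<^esub> b =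
            (e \<otimes> x b) \<odot>\<^bsub>M\<^esub> b \<oplus>\<^bsub>M\<^esub> (e \<otimes> y b) \<odot>\<^bsub>M\<^esub> b"
          using b M.smult_l_distr [of "e \<otimes> x b" "e \<otimes> y b" b]
          by (simp add: free_module_simps r_distr)
      qed (use terms [OF x] terms [OF y] in auto)
      also have "\<dots> = \<pi> x \<oplus>\<^bsub>M\<^esub> \<pi> y"
        unfolding \<pi>_def by (rule M.M.finsum_addf [OF terms [OF x] terms [OF y]])
      finally show ?thesis by simp
    qed
    show "\<pi> (r \<odot>\<^bsub>free_module R B\<^esub> x) = r \<odot>\<^bsub>inflate_module R e M\<^esub> \<pi> x" if r: "r \<in> carrier R" for r
    proof -
      have "(e \<otimes> r) \<odot>\<^bsub>M\<^esub> \<pi> x = (\<Oplus>\<^bsub>M\<^esub>b\<in>B. (e \<otimes> r) \<odot>\<^bsub>M\<^esub> ((e \<otimes> x b) \<odot>\<^bsub>M\<^esub> b))"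
        unfolding \<pi>_def using r
        by (intro additive_finsum [OF _ _ _ _ B(1) terms [OF x]] M.M.abelian_group_axioms
            M.smult_closed M.smult_r_distr) auto
      also have "\<dots> = \<pi> (r \<odot>\<^bsub>free_module R B\<^esub> x)"
        unfolding \<pi>_def
      proof (intro M.M.finsum_cong' refl Pi_I)
        fix b assume b: "b \<in> B"
        then have bx: "b \<in> carrier M" "x b \<in> carrier R"
          using B x by auto
        show "(e \<otimes> (r \<odot>\<^bsub>free_module R B\<^esub> x) b) \<odot>\<^bsub>M\<^esub> b \<in> carrier M"
          using b bx r by (intro M.smult_closed) (auto simp: free_module_simps)
        have "(e \<otimes> r) \<otimes> (e \<otimes> x b) = e \<otimes> (r \<otimes> x b)"
          using bx r by (intro idem_mult_idem)
        then show "(e \<otimes> r) \<odot>\<^bsub>M\<^esub> ((e \<otimes> x b) \<odot>\<^bsub>M\<^esub> b) = (e \<otimes> (r \<odot>\<^bsub>free_module R B\<^esub> x) b) \<odot>\<^bsub>M\<^esub> b"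
          using b bx r M.smult_assoc1 [of "e \<otimes> r" "e \<otimes> x b" b] by (simp add: free_module_simps)
      qed
      finally show ?thesis by simp
    qed
  qed
  have \<kappa>_eqI: "\<kappa> x = c"
    if "x \<in> carrier M" "c \<in> B \<rightarrow>\<^sub>E carrier R" "\<And>b. b \<in> B \<Longrightarrow> e \<otimes> c b = c b" "\<pi> c = x" for x c
  proof -
    have "(\<Oplus>\<^bsub>M\<^esub>b\<in>B. c b \<odot>\<^bsub>M\<^esub> b) = \<pi> c"
      unfolding \<pi>_def using that terms [OF that(2)] by (intro M.M.finsum_cong') auto
    then have "c \<in> B \<rightarrow>\<^sub>E carrier ?C \<and> x = (\<Oplus>\<^bsub>M\<^esub>b\<in>B. c b \<odot>\<^bsub>M\<^esub> b)"
      using that by (simp add: PiE_iff)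
    then show ?thesis
      unfolding \<kappa>_def by (rule the1_equality [OF ex1 [OF that(1)]])
  qed
  have \<kappa>_closed: "\<kappa> x \<in> B \<rightarrow>\<^sub>E carrier R" if "x \<in> carrier M" for x
    using \<kappa>_props [OF that] by (auto simp: PiE_iff)
  have "\<kappa> \<in> left_module_hom R (inflate_module R e M) (free_module R B)"
  proof (rule left_module_homI)
    fix x assume "x \<in> carrier (inflate_module R e M)"
    then have x: "x \<in> carrier M" by simp
    show "\<kappa> x \<in> carrier (free_module R B)"
      using \<kappa>_closed [OF x] by (simp add: free_module_simps)
    show "\<kappa> (x \<oplus>\<^bsub>inflate_module R e M\<^esub> y) = \<kappa> x \<oplus>\<^bsub>free_module R B\<^esub> \<kappa> y"
      if "y \<in> carrier (inflate_module R e M)" for y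
    proof (rule \<kappa>_eqI)
      have y: "y \<in> carrier M" using that by simp
      show "x \<oplus>\<^bsub>inflate_module R e M\<^esub> y \<in> carrier M"
        using x y by simp
      show "\<kappa> x \<oplus>\<^bsub>free_module R B\<^esub> \<kappa> y \<in> B \<rightarrow>\<^sub>E carrier R"
        using \<kappa>_mem(1) x y by (auto simp: free_module_simps)
      show "e \<otimes> (\<kappa> x \<oplus>\<^bsub>free_module R B\<^esub> \<kappa> y) b = (\<kappa> x \<oplus>\<^bsub>free_module R B\<^esub> \<kappa> y) b" if "b \<in> B" for b
        using \<kappa>_mem x y that by (simp add: free_module_simps r_distr)
      show "\<pi> (\<kappa> x \<oplus>\<^bsub>free_module R B\<^esub> \<kappa> y) = x \<oplus>\<^bsub>inflate_module R e M\<^esub> y"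
        using left_module_homD(2) [OF \<pi>_hom, of "\<kappa> x" "\<kappa> y"] \<kappa>_closed x y \<pi>\<kappa>
        by (simp add: free_module_simps(1))
    qed
    show "\<kappa> (r \<odot>\<^bsub>inflate_module R e M\<^esub> x) = r \<odot>\<^bsub>free_module R B\<^esub> \<kappa> x" if r: "r \<in> carrier R" for r
    proof (rule \<kappa>_eqI)
      show "r \<odot>\<^bsub>inflate_module R e M\<^esub> x \<in> carrier M"
        using r x M.smult_closed [of "e \<otimes> r" x] by simp
      show "r \<odot>\<^bsub>free_module R B\<^esub> \<kappa> x \<in> B \<rightarrow>\<^sub>E carrier R"
        using \<kappa>_mem(1) x r by (auto simp: free_module_simps)
      show "e \<otimes> (r \<odot>\<^bsub>free_module R B\<^esub> \<kappa> x) b = (r \<odot>\<^bsub>free_module R B\<^esub> \<kappa> x) b" if "b \<in> B" for b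
        using \<kappa>_mem x r that by (simp add: free_module_simps central_assoc)
      show "\<pi> (r \<odot>\<^bsub>free_module R B\<^esub> \<kappa> x) = r \<odot>\<^bsub>inflate_module R e M\<^esub> x"
        using left_module_homD(3) [OF \<pi>_hom r, of "\<kappa> x"] \<kappa>_closed x \<pi>\<kappa>
        by (simp add: free_module_simps(1))
    qed
  qed
  then show ?thesis
    by (rule that [OF B(1) \<pi>_hom]) (rule \<pi>\<kappa>)
qed

text \<open>If all coefficients lie in \<open>e R\<close>, then a combination of the elements \<open>e b\<close> equals the same
  combination of the elements \<open>b\<close>. So coefficients over \<open>e b\<close> are unique, and they exist because the
  coefficients of an element \<open>x = e x\<close> over \<open>B\<close> are fixed by \<open>e\<close>.\<close>

lemma fg_free_corner:
  assumes "fg_free_module R M"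
  shows "fg_free_module (corner_ring R e) (corner_module R e M)"
proof -
  let ?C = "corner_ring R e" and ?M = "corner_module R e M"
  obtain B where lm: "left_module R M" and basis: "finite_module_basis R M B"
    using assms unfolding fg_free_module_def by blast
  interpret M: left_module R M by fact
  interpret C: left_module ?C ?M by (rule left_module_corner) fact
  have B: "finite B" "B \<subseteq> carrier M"
    using basis unfolding finite_module_basis_def by blast+
  have ex1: "\<exists>!c. c \<in> B \<rightarrow>\<^sub>E carrier R \<and> x = (\<Oplus>\<^bsub>M\<^esub>b\<in>B. c b \<odot>\<^bsub>M\<^esub> b)"
    if "x \<in> carrier M" for x
    using basis that unfolding finite_module_basis_def by (elim conjE) (drule bspec)
  have eb: "(\<lambda>b. e \<odot>\<^bsub>M\<^esub> b) \<in> B \<rightarrow> carrier ?M"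
    using B by (auto simp flip: M.smult_assoc1)
  have sum: "(\<Oplus>\<^bsub>?M\<^esub>b\<in>B. c b \<odot>\<^bsub>?M\<^esub> (e \<odot>\<^bsub>M\<^esub> b)) = (\<Oplus>\<^bsub>M\<^esub>b\<in>B. c b \<odot>\<^bsub>M\<^esub> b)"
    if c: "c \<in> B \<rightarrow>\<^sub>E carrier ?C" for c
  proof -
    have cb: "c b \<in> carrier R" "e \<otimes> c b = c b" if "b \<in> B" for b
      using PiE_mem [OF c that] by simp_all
    have "(\<Oplus>\<^bsub>?M\<^esub>b\<in>B. c b \<odot>\<^bsub>?M\<^esub> (e \<odot>\<^bsub>M\<^esub> b)) = (\<Oplus>\<^bsub>M\<^esub>b\<in>B. c b \<odot>\<^bsub>?M\<^esub> (e \<odot>\<^bsub>M\<^esub> b))"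
      using additive_finsum [of ?M M "\<lambda>x. x" B "\<lambda>b. c b \<odot>\<^bsub>?M\<^esub> (e \<odot>\<^bsub>M\<^esub> b)"]
        C.M.abelian_group_axioms M.M.abelian_group_axioms B(1) C.smult_closed [OF PiE_mem [OF c]] eb
      by auto
    also have "\<dots> = (\<Oplus>\<^bsub>M\<^esub>b\<in>B. c b \<odot>\<^bsub>M\<^esub> b)"
    proof (intro M.M.finsum_cong' refl Pi_I)
      fix b assume b: "b \<in> B"
      then have "b \<in> carrier M" using B by blast
      with b cb [OF b] show "c b \<odot>\<^bsub>?M\<^esub> (e \<odot>\<^bsub>M\<^esub> b) = c b \<odot>\<^bsub>M\<^esub> b" "c b \<odot>\<^bsub>M\<^esub> b \<in> carrier M"
        by (simp_all add: central flip: M.smult_assoc1)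
    qed
    finally show ?thesis .
  qed
  have "finite_module_basis ?C ?M ((\<lambda>b. e \<odot>\<^bsub>M\<^esub> b) ` B)"
  proof (rule finite_module_basis_indexed [OF C.left_module_axioms _ B(1) eb])
    show "\<one>\<^bsub>?C\<^esub> \<noteq> \<zero>\<^bsub>?C\<^esub>" using idem_nonzero by simp
    fix x assume "x \<in> carrier ?M"
    then have x: "x \<in> carrier M" "e \<odot>\<^bsub>M\<^esub> x = x" by simp_all
    obtain c where c: "c \<in> B \<rightarrow>\<^sub>E carrier R" "x = (\<Oplus>\<^bsub>M\<^esub>b\<in>B. c b \<odot>\<^bsub>M\<^esub> b)"
      and uniq: "\<And>c'. c' \<in> B \<rightarrow>\<^sub>E carrier R \<Longrightarrow> x = (\<Oplus>\<^bsub>M\<^esub>b\<in>B. c' b \<odot>\<^bsub>M\<^esub> b) \<Longrightarrow> c' = c"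
      using ex1 [OF x(1)] by (elim ex1E) blast
    have cb: "c b \<in> carrier R" "b \<in> carrier M" if "b \<in> B" for b
      using c(1) B that by auto
    have "x = e \<odot>\<^bsub>M\<^esub> (\<Oplus>\<^bsub>M\<^esub>b\<in>B. c b \<odot>\<^bsub>M\<^esub> b)"
      using x(2) c(2) by simp
    also have "\<dots> = (\<Oplus>\<^bsub>M\<^esub>b\<in>B. e \<odot>\<^bsub>M\<^esub> (c b \<odot>\<^bsub>M\<^esub> b))"
      using cb by (intro additive_finsum M.M.abelian_group_axioms B M.smult_r_distr) auto
    also have "\<dots> = (\<Oplus>\<^bsub>M\<^esub>b\<in>B. (\<lambda>b\<in>B. e \<otimes> c b) b \<odot>\<^bsub>M\<^esub> b)"
      using cb by (intro M.M.finsum_cong') (auto simp: M.smult_assoc1)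
    finally have "(\<lambda>b\<in>B. e \<otimes> c b) = c"
      using cb by (intro uniq) auto
    then have "e \<otimes> c b = c b" if "b \<in> B" for b
      using that by (metis restrict_apply')
    then have cC: "c \<in> B \<rightarrow>\<^sub>E carrier ?C"
      using c(1) by (auto simp: PiE_iff)
    show "\<exists>!c. c \<in> B \<rightarrow>\<^sub>E carrier ?C \<and> x = (\<Oplus>\<^bsub>?M\<^esub>b\<in>B. c b \<odot>\<^bsub>?M\<^esub> (e \<odot>\<^bsub>M\<^esub> b))"
    proof (rule ex1I [of _ c])
      show "c \<in> B \<rightarrow>\<^sub>E carrier ?C \<and> x = (\<Oplus>\<^bsub>?M\<^esub>b\<in>B. c b \<odot>\<^bsub>?M\<^esub> (e \<odot>\<^bsub>M\<^esub> b))"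
        unfolding sum [OF cC] using cC c(2) by (rule conjI)
      fix c' assume c': "c' \<in> B \<rightarrow>\<^sub>E carrier ?C \<and> x = (\<Oplus>\<^bsub>?M\<^esub>b\<in>B. c' b \<odot>\<^bsub>?M\<^esub> (e \<odot>\<^bsub>M\<^esub> b))"
      then have "c' \<in> B \<rightarrow>\<^sub>E carrier R" by (auto simp: PiE_iff)
      moreover have "x = (\<Oplus>\<^bsub>M\<^esub>b\<in>B. c' b \<odot>\<^bsub>M\<^esub> b)"
        using conjunct2 [OF c'] unfolding sum [OF conjunct1 [OF c']] .
      ultimately show "c' = c" by (rule uniq)
    qed
  qed
  then show ?thesis
    unfolding fg_free_module_def using C.left_module_axioms by blast
qed

lemma partial_resolution_inflate:
  assumes "left_module R Z" and trivial: "\<And>z. z \<in> carrier Z \<Longrightarrow> e \<odot>\<^bsub>Z\<^esub> z = z"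
    and res: "partial_resolution (corner_ring R e) Z n A d \<epsilon>"
  shows "partial_resolution R Z n (\<lambda>i. inflate_module R e (A i)) d \<epsilon>"
proof (rule partial_resolutionI)
  interpret Z: left_module R Z by fact
  note \<epsilon> = left_module_homD [OF partial_resolutionD(3) [OF res]]
  show "left_module R (inflate_module R e (A i))" if "i \<le> n" for i
    using partial_resolutionD(1) [OF res that] by (rule left_module_inflate)
  show "d i \<in> left_module_hom R (inflate_module R e (A (Suc i))) (inflate_module R e (A i))" if "i < n" for i
    using left_module_homD [OF partial_resolutionD(2) [OF res that]] by (intro left_module_homI) auto
  show "\<epsilon> \<in> left_module_hom R (inflate_module R e (A 0)) Z"
  proof (rule left_module_homI)
    fix r x assume "r \<in> carrier R" "x \<in> carrier (inflate_module R e (A 0))"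
    then show "\<epsilon> (r \<odot>\<^bsub>inflate_module R e (A 0)\<^esub> x) = r \<odot>\<^bsub>Z\<^esub> \<epsilon> x"
      using \<epsilon>(1) \<epsilon>(3) [of "e \<otimes> r" x] trivial by (simp add: Z.smult_assoc1)
  qed (use \<epsilon> in auto)
  show "\<epsilon> ` carrier (inflate_module R e (A 0)) = carrier Z"
    using partial_resolutionD(4) [OF res] by simp
  show "d 0 ` carrier (inflate_module R e (A (Suc 0))) =
      {x \<in> carrier (inflate_module R e (A 0)). \<epsilon> x = \<zero>\<^bsub>Z\<^esub>}" if "0 < n"
    using partial_resolutionD(5) [OF res that] by simp
  show "d (Suc i) ` carrier (inflate_module R e (A (Suc (Suc i)))) =
      {x \<in> carrier (inflate_module R e (A (Suc i))). d i x = \<zero>\<^bsub>inflate_module R e (A i)\<^esub>}" if "Suc i < n" for i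
    using partial_resolutionD(6) [OF res that] by simp
qed

text \<open>Exactness of \<open>M \<mapsto> e M\<close>: if \<open>y = f x\<close> is fixed by \<open>e\<close>, then also \<open>y = f (e x)\<close>.\<close>

lemma image_corner_module:
  assumes "left_module R M" "f \<in> left_module_hom R M N"
  shows "f ` carrier (corner_module R e M) = {y \<in> f ` carrier M. e \<odot>\<^bsub>N\<^esub> y = y}"
proof -
  interpret M: left_module R M by fact
  note f = left_module_homD [OF assms(2)]
  show ?thesis
  proof (intro equalityI subsetI)
    fix y assume "y \<in> f ` carrier (corner_module R e M)"
    then obtain x where "x \<in> carrier M" "e \<odot>\<^bsub>M\<^esub> x = x" "y = f x" by auto
    then show "y \<in> {y \<in> f ` carrier M. e \<odot>\<^bsub>N\<^esub> y = y}"
      using f(3) [of e x] by simp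
  next
    fix y assume "y \<in> {y \<in> f ` carrier M. e \<odot>\<^bsub>N\<^esub> y = y}"
    then obtain x where x: "x \<in> carrier M" "y = f x" "e \<odot>\<^bsub>N\<^esub> f x = f x" by auto
    then have "y = f (e \<odot>\<^bsub>M\<^esub> x)"
      using f(3) by simp
    moreover have "e \<odot>\<^bsub>M\<^esub> x \<in> carrier (corner_module R e M)"
      using x by (simp flip: M.smult_assoc1)
    ultimately show "y \<in> f ` carrier (corner_module R e M)"
      by (rule image_eqI)
  qed
qed

lemma partial_resolution_corner:
  assumes trivial: "\<And>z. z \<in> carrier Z \<Longrightarrow> e \<odot>\<^bsub>Z\<^esub> z = z"
    and res: "partial_resolution R Z n A d \<epsilon>"
  shows "partial_resolution (corner_ring R e) Z n (\<lambda>i. corner_module R e (A i)) d \<epsilon>"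
proof (rule partial_resolutionI)
  let ?E = "corner_module R e"
  note A = partial_resolutionD(1) [OF res] and d = partial_resolutionD(2) [OF res]
    and \<epsilon> = partial_resolutionD(3) [OF res]
  have im: "d i ` carrier (?E (A (Suc i))) = {y \<in> d i ` carrier (A (Suc i)). e \<odot>\<^bsub>A i\<^esub> y = y}"
    if "i < n" for i
    using that by (intro image_corner_module A d) auto
  show "left_module (corner_ring R e) (?E (A i))" if "i \<le> n" for i
    using A [OF that] by (rule left_module_corner)
  show "d i \<in> left_module_hom (corner_ring R e) (?E (A (Suc i))) (?E (A i))" if "i < n" for i
    using left_module_homD [OF d [OF that]] by (intro left_module_homI) (auto, metis idem_closed)
  show "\<epsilon> \<in> left_module_hom (corner_ring R e) (?E (A 0)) Z"
    using left_module_homD [OF \<epsilon>] by (intro left_module_homI) auto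
  show "\<epsilon> ` carrier (?E (A 0)) = carrier Z"
    using image_corner_module [OF A \<epsilon>] partial_resolutionD(4) [OF res] trivial by auto
  show "d 0 ` carrier (?E (A (Suc 0))) = {x \<in> carrier (?E (A 0)). \<epsilon> x = \<zero>\<^bsub>Z\<^esub>}" if "0 < n"
    using im [OF that] partial_resolutionD(5) [OF res that] by auto
  show "d (Suc i) ` carrier (?E (A (Suc (Suc i)))) = {x \<in> carrier (?E (A (Suc i))). d i x = \<zero>\<^bsub>?E (A i)\<^esub>}"
    if "Suc i < n" for i
    using im [OF that] partial_resolutionD(6) [OF res that] by auto
qed

lemma free_partial_resolution_from_corner:
  fixes A :: "nat \<Rightarrow> ('a, 'm) module"
  assumes "left_module R Z" and "\<And>z. z \<in> carrier Z \<Longrightarrow> e \<odot>\<^bsub>Z\<^esub> z = z"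
    and res: "partial_resolution (corner_ring R e) Z n A d \<epsilon>"
    and free: "\<And>i. i \<le> n \<Longrightarrow> fg_free_module (corner_ring R e) (A i)"
  shows "\<exists>(C :: nat \<Rightarrow> ('a, nat \<times> 'm \<Rightarrow> 'a) module) D \<epsilon>'.
    partial_resolution R Z n C D \<epsilon>' \<and> (\<forall>i\<le>n. fg_free_module R (C i))"
proof -
  have "\<forall>i\<in>{..n}. \<exists>(B :: 'm set) \<pi> \<kappa>. finite B
      \<and> \<pi> \<in> left_module_hom R (free_module R B) (inflate_module R e (A i))
      \<and> \<kappa> \<in> left_module_hom R (inflate_module R e (A i)) (free_module R B)
      \<and> (\<forall>x\<in>carrier (A i). \<pi> (\<kappa> x) = x)" (is "\<forall>i\<in>_. \<exists>B \<pi> \<kappa>. ?P i B \<pi> \<kappa>")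
  proof
    fix i assume "i \<in> {..n}"
    then obtain B :: "'m set" and \<pi> \<kappa> where "?P i B \<pi> \<kappa>"
      using corner_free_retract [OF free [of i]] by (metis atMost_iff)
    then show "\<exists>(B :: 'm set) \<pi> \<kappa>. ?P i B \<pi> \<kappa>" by blast
  qed
  then obtain B :: "nat \<Rightarrow> 'm set" and \<pi> \<kappa> where *: "\<And>i. i \<in> {..n} \<Longrightarrow> ?P i (B i) (\<pi> i) (\<kappa> i)"
    by metis
  have "\<exists>D \<epsilon>'. partial_resolution R Z n (\<lambda>i. free_module R (Sigma {..i} B)) D \<epsilon>'"
    using * partial_resolution_inflate [OF assms(1-3)] ring_axioms
    by (intro free_resolution_of_retracts [where \<pi> = \<pi> and \<kappa> = \<kappa>]) auto
  moreover have "fg_free_module R (free_module R (Sigma {..i} B))" if "i \<le> n" for i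
  proof (rule fg_free_free_module)
    show "\<one> \<noteq> \<zero>"
      using idem_nonzero r_one [of e] r_null [of e] by force
    show "finite (Sigma {..i} B)"
      using * that by (intro finite_SigmaI) auto
  qed (rule ring_axioms)
  ultimately show ?thesis by blast
qed

end

section \<open>Monoid ideals with an identity\<close>

lemma central_idempotent_monoid_ring:
  fixes S (structure)
  assumes "monoid S" "monoid_ideal T S" "e \<in> T" and e: "\<And>t. t \<in> T \<Longrightarrow> e \<otimes> t = t \<and> t \<otimes> e = t"
  shows "central_idempotent (monoid_ring S) (frag_of e)"
proof (intro central_idempotent.intro central_idempotent_axioms.intro)
  interpret monoid S by fact
  have T: "T \<subseteq> carrier S" "\<And>s. s \<in> carrier S \<Longrightarrow> s \<otimes> e \<in> T \<and> e \<otimes> s \<in> T"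
    using assms(2,3) by (auto simp: monoid_ideal_def)
  show "ring (monoid_ring S)" by (rule ring_monoid_ring)
  show "frag_of e \<in> carrier (monoid_ring S)"
    using T \<open>e \<in> T\<close> by auto
  show "frag_of e \<otimes>\<^bsub>monoid_ring S\<^esub> frag_of e = frag_of e"
    using e \<open>e \<in> T\<close> by simp
  show "frag_of e \<noteq> \<zero>\<^bsub>monoid_ring S\<^esub>" by simp
  \<comment> \<open>The ideal contains \<open>s e\<close> and \<open>e s\<close>, so \<open>s e = e (s e) = (e s) e = e s\<close>.\<close>
  have central: "s \<otimes> e = e \<otimes> s" if "s \<in> carrier S" for s
    using e [of "s \<otimes> e"] e [of "e \<otimes> s"] T that m_assoc [of e s e] \<open>e \<in> T\<close> by auto
  fix r assume "r \<in> carrier (monoid_ring S)"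
  then have "Poly_Mapping.keys r \<subseteq> carrier S" by simp
  then show "r \<otimes>\<^bsub>monoid_ring S\<^esub> frag_of e = frag_of e \<otimes>\<^bsub>monoid_ring S\<^esub> r"
    by (induction r rule: frag_induction) (simp_all add: frag_extend_diff central)
qed

text \<open>Left multiplication by \<open>e\<close> moves every support into the ideal and fixes the elements that are
  supported there.\<close>

lemma corner_ring_monoid_ring:
  fixes S (structure)
  assumes "monoid_ideal T S" "e \<in> T" and e: "\<And>t. t \<in> T \<Longrightarrow> e \<otimes> t = t \<and> t \<otimes> e = t"
  shows "corner_ring (monoid_ring S) (frag_of e) = monoid_ring (S\<lparr>carrier := T, one := e\<rparr>)"
proof -
  have T: "T \<subseteq> carrier S" "\<And>s. s \<in> carrier S \<Longrightarrow> e \<otimes> s \<in> T"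
    using assms by (auto simp: monoid_ideal_def)
  have "Poly_Mapping.keys r \<subseteq> carrier S \<and> frag_of e \<otimes>\<^bsub>monoid_ring S\<^esub> r = r \<longleftrightarrow>
      Poly_Mapping.keys r \<subseteq> T" for r
  proof
    assume r: "Poly_Mapping.keys r \<subseteq> carrier S \<and> frag_of e \<otimes>\<^bsub>monoid_ring S\<^esub> r = r"
    then have "Poly_Mapping.keys r = Poly_Mapping.keys (frag_extend (\<lambda>t. frag_of (e \<otimes> t)) r)"
      by simp
    also have "\<dots> \<subseteq> T"
      using keys_frag_extend [of "\<lambda>t. frag_of (e \<otimes> t)" r] T r by fastforce
    finally show "Poly_Mapping.keys r \<subseteq> T" .
  next
    assume r: "Poly_Mapping.keys r \<subseteq> T"
    then have "frag_of e \<otimes>\<^bsub>monoid_ring S\<^esub> r = r"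
      by (induction r rule: frag_induction) (simp_all add: frag_extend_diff e)
    then show "Poly_Mapping.keys r \<subseteq> carrier S \<and> frag_of e \<otimes>\<^bsub>monoid_ring S\<^esub> r = r"
      using r T by blast
  qed
  then show ?thesis
    by (simp add: corner_ring_def monoid_ring_def)
qed

theorem theorem3:
  fixes S :: "('a, 'b) monoid_scheme" (structure) and T :: "'a set" and e :: 'a and n :: nat
  assumes "monoid S"
    and "monoid_ideal T S"
    and "e \<in> T"
    and "\<And>t. t \<in> T \<Longrightarrow> e \<otimes> t = t \<and> t \<otimes> e = t"
  shows "left_FP n S \<longleftrightarrow> left_FP n (S\<lparr>carrier := T, one := e\<rparr>)"
proof -
  let ?R = "monoid_ring S" and ?e = "frag_of e" and ?T = "S\<lparr>carrier := T, one := e\<rparr>"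
  let ?Z = "trivial_module :: ('a \<Rightarrow>\<^sub>0 int, int) module"
  interpret central_idempotent ?R ?e
    using assms by (rule central_idempotent_monoid_ring)
  have corner: "monoid_ring ?T = corner_ring ?R ?e"
    by (rule corner_ring_monoid_ring [OF assms(2-4), symmetric])
  have trivial: "?e \<odot>\<^bsub>?Z\<^esub> k = k" for k
    by simp
  show ?thesis
  proof
    assume "left_FP n S"
    then obtain A :: "nat \<Rightarrow> ('a \<Rightarrow>\<^sub>0 int, nat \<Rightarrow> 'a \<Rightarrow>\<^sub>0 int) module" and d \<epsilon>
      where "partial_resolution ?R ?Z n A d \<epsilon>" "\<forall>i\<le>n. fg_free_module ?R (A i)"
      unfolding left_FP_def free_partial_resolution_iff by blast
    then have "free_partial_resolution n ?T (\<lambda>i. corner_module ?R ?e (A i)) d \<epsilon>"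
      unfolding free_partial_resolution_iff corner
      using partial_resolution_corner [OF trivial] fg_free_corner by blast
    then show "left_FP n ?T" by (rule left_FP_if_resolution)
  next
    assume "left_FP n ?T"
    then obtain A :: "nat \<Rightarrow> ('a \<Rightarrow>\<^sub>0 int, nat \<Rightarrow> 'a \<Rightarrow>\<^sub>0 int) module" and d \<epsilon>
      where "partial_resolution (corner_ring ?R ?e) ?Z n A d \<epsilon>"
        "\<And>i. i \<le> n \<Longrightarrow> fg_free_module (corner_ring ?R ?e) (A i)"
      unfolding left_FP_def free_partial_resolution_iff corner by blast
    from free_partial_resolution_from_corner
        [OF monoid.left_module_trivial_module [OF assms(1)] trivial this]
    show "left_FP n S"
      unfolding free_partial_resolution_iff [symmetric] by (blast intro: left_FP_if_resolution)
  qed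
qed

end
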